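(* Let $F=(f_1,\ldots,f_n)^T$ be a polynomial system with $f_i\in\mathbb{R}[x_1,\ldots,x_n]$, let $\mu\ge 2$ be an integer, and let $G(\mathbf{x},\mathbf{b},\mathbf{a})$ be the deflated system of $\mu n$ equations in $\mu n$ variables associated with $F$ and $\mu$ (defined in the context). Suppose that the verification theorem (stated in the context) is applicable to $G(\mathbf{x},\mathbf{b},\mathbf{a})$ and yields inclusions for $\hat{\mathbf{x}}$, $\hat{\mathbf{b}}$ and $\hat{\mathbf{a}}$ such that $G(\hat{\mathbf{x}},\hat{\mathbf{b}},\hat{\mathbf{a}})=0$. Then $\hat{\mathbf{x}}$ is an isolated breadth-one root of $F_0(\mathbf{x}):=F_1(\mathbf{x},\hat{\mathbf{b}})$ with multiplicity $\mu$.
   Context: Multiplicity and breadth one. The multiplicity of an isolated root $\hat{\mathbf{x}}$ of a system $\{g_1,\ldots,g_n\}$ is the dimension of $\mathbb{R}[\mathbf{x}]/Q_{\hat{\mathbf{x}}}$, where $Q_{\hat{\mathbf{x}}}$ is the isolated primary component of the ideal $(g_1,\ldots,g_n)$ whose associated prime is $(x_1-\hat{x}_1,\ldots,x_n-\hat{x}_n)$. The root is breadth-one if the Jacobian matrix of the system at $\hat{\mathbf{x}}$ has corank one (rank $n-1$). Deflated system. Introduce smoothing parameters $\mathbf{b}=[b_0,b_1,\ldots,b_{\mu-2}]$ and parameters $\mathbf{a}=[\mathbf{a}_2,\ldots,\mathbf{a}_\mu]$ with $\mathbf{a}_2=[1,a_{2,2},\ldots,a_{2,n}]^T$ and $\mathbf{a}_k=[0,a_{k,2},\ldots,a_{k,n}]^T$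 for $2<k\le\mu$; the unknowns in $\mathbf{a}$ are the $a_{k,j}$, $2\le k\le\mu$, $2\le j\le n$. Let $\mathbf{e}_1=(1,0,\ldots,0)^T\in\mathbb{R}^n$ and $$F_1(\mathbf{x},\mathbf{b})=F(\mathbf{x})-\left(\sum_{\nu=0}^{\mu-2}\frac{b_\nu x_1^\nu}{\nu!}\right)\mathbf{e}_1 .$$ For a system $H$ of $n$ polynomials let $J_H$ denote its $n\times n$ Jacobian matrix with respect to $\mathbf{x}$ (all $a_{k,j}$ and $b_\nu$ treated as constants), and define recursively $L_2(H)=J_H\cdot\mathbf{a}_2$ and, for $k\ge 3$, $$P_k(H)=\sum_{j=1}^{k-2}\frac{j}{k-1}\,J_{L_{k-j}(H)}\cdot\mathbf{a}_{j+1},\qquad L_k(H)=P_k(H)+J_H\cdot\mathbf{a}_k .$$ Put $F_k(\mathbf{x},\mathbf{b},\mathbf{a}_2,\ldots,\mathbf{a}_k)=L_k(F_1)$ for $2\le k\le\mu$, and let $G(\mathbf{x},\mathbf{b},\mathbf{a})$ be the system obtained by stacking $F_1(\mathbf{x},\mathbf{b}),F_2(\mathbf{x},\mathbf{b},\mathbf{a}_2),\ldots,F_\mu(\mathbf{x},\mathbf{b},\mathbf{a}_2,\ldots,\mathbf{a}_\mu)$. It has $N=\mu n$ equations $G_1,\ldots,G_N$ in the $N$ variables $x_1,\ldots,x_n$, $b_0,\ldots,b_{\mu-2}$, $a_{k,j}$, collectively denoted $\mathbf{y}$; $J_G$ denotes its $N\times N$ Jacobian matrix with respect to $\mathbf{y}$.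 Verification theorem (attributed to Krawczyk, Moore, Rump), written for the system $G$. Let $\mathbb{IR}$ denote the set of compact real intervals and $\mathrm{int}$ the interior. Let $\tilde{\mathbf{y}}\in\mathbb{R}^N$ be a real point, let $Y\in\mathbb{IR}^N$ be an interval domain with $\tilde{\mathbf{y}}\in Y$, and let $M\in\mathbb{IR}^{N\times N}$ be an interval matrix with $\nabla G_i(Y)\subseteq M_{i,:}$ (the $i$-th row of $M$) for $i=1,\ldots,N$. Denote by $I$ the $N\times N$ identity matrix and assume $$-J_G(\tilde{\mathbf{y}})\,G(\tilde{\mathbf{y}})+(I-J_G(\tilde{\mathbf{y}})M)\,Y\subseteq\mathrm{int}(Y).$$ Then there is a unique $\hat{\mathbf{y}}\in Y$ with $G(\hat{\mathbf{y}})=0$. Moreover, every matrix $\tilde M\in M$ is nonsingular; in particular, the Jacobian matrix $J_G(\hat{\mathbf{y}})$ is nonsingular. The theorem is applicable to $G$ when such $\tilde{\mathbf{y}}$, $Y$, $M$ satisfying these hypotheses are given; the components of $Y$ are then the inclusions for the components of $\hat{\mathbf{y}}=(\hat{\mathbf{x}},\hat{\mathbf{b}},\hat{\mathbf{a}})$. *)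

theory Defs
  imports
    Complex_Main
    "HOL-Analysis.Elementary_Topology"
    "HOL-Library.Poly_Mapping"
    "HOL-Library.Interval"
    "HOL-Algebra.Ideal"
    "HOL-Algebra.QuotRing"
    "HOL-Algebra.Embedded_Algebras"
    "Jordan_Normal_Form.DL_Rank"
begin

text \<open>Everything is indexed from 0: the paper's \<open>x\<^sub>1, \<dots>, x\<^sub>n\<close> are the variables \<open>0, \<dots>, n - 1\<close>,
  and likewise for components of vectors and equations of systems. Polynomials live in countably
  many variables; \<open>\<real>[x\<^sub>1, \<dots>, x\<^sub>n]\<close> is the ring \<open>mp_ring n\<close> of those that only use variables
  below \<open>n\<close>. A point is a function \<open>nat \<Rightarrow> real\<close> of which only the first components matter.\<close>

subsection \<open>Multivariate real polynomials\<close>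

type_synonym mpoly = "(nat \<Rightarrow>\<^sub>0 nat) \<Rightarrow>\<^sub>0 real"

definition mp_const :: "real \<Rightarrow> mpoly" where
  "mp_const c = Poly_Mapping.single 0 c"

definition mp_var :: "nat \<Rightarrow> mpoly" where
  "mp_var i = Poly_Mapping.single (Poly_Mapping.single i 1) 1"

definition mp_vars :: "mpoly \<Rightarrow> nat set" where
  "mp_vars p = (\<Union>m\<in>Poly_Mapping.keys p. Poly_Mapping.keys m)"

definition mp_eval :: "mpoly \<Rightarrow> (nat \<Rightarrow> real) \<Rightarrow> real" where
  "mp_eval p x = (\<Sum>m\<in>Poly_Mapping.keys p. Poly_Mapping.lookup p m *
     (\<Prod>i\<in>Poly_Mapping.keys m. x i ^ Poly_Mapping.lookup m i))"

text \<open>Formal partial derivative. The subtraction of exponents is truncated, but it only truncates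
  in terms whose coefficient is 0.\<close>

definition mp_pderiv :: "nat \<Rightarrow> mpoly \<Rightarrow> mpoly" where
  "mp_pderiv i p = (\<Sum>m\<in>Poly_Mapping.keys p.
     Poly_Mapping.single (m - Poly_Mapping.single i 1)
       (real (Poly_Mapping.lookup m i) * Poly_Mapping.lookup p m))"

definition mp_ring :: "nat \<Rightarrow> mpoly ring" where
  "mp_ring n = \<lparr>carrier = {p. mp_vars p \<subseteq> {..<n}}, mult = (*), one = 1, zero = 0, add = (+)\<rparr>"

definition jacobian :: "nat \<Rightarrow> (nat \<Rightarrow> mpoly) \<Rightarrow> (nat \<Rightarrow> real) \<Rightarrow> real mat" where
  "jacobian n g x = mat n n (\<lambda>(i, j). mp_eval (mp_pderiv j (g i)) x)"

definition is_root :: "nat \<Rightarrow> (nat \<Rightarrow> mpoly) \<Rightarrow> (nat \<Rightarrow> real) \<Rightarrow> bool" where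
  "is_root n g x \<longleftrightarrow> (\<forall>i<n. mp_eval (g i) x = 0)"

subsection \<open>Isolated primary components\<close>

definition primary_ideal :: "'a set \<Rightarrow> ('a, 'b) ring_scheme \<Rightarrow> bool" where
  "primary_ideal Q R \<longleftrightarrow> ideal Q R \<and> Q \<noteq> carrier R \<and>
     (\<forall>a\<in>carrier R. \<forall>b\<in>carrier R. a \<otimes>\<^bsub>R\<^esub> b \<in> Q \<longrightarrow> a \<in> Q \<or> (\<exists>k::nat. b [^]\<^bsub>R\<^esub> k \<in> Q))"

definition ideal_radical :: "('a, 'b) ring_scheme \<Rightarrow> 'a set \<Rightarrow> 'a set" where
  "ideal_radical R Q = {a \<in> carrier R. \<exists>k::nat. a [^]\<^bsub>R\<^esub> k \<in> Q}"

text \<open>Irredundant primary decomposition. Intersecting with the carrier gives the empty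
  intersection its correct value.\<close>

definition primary_decomposition :: "('a, 'b) ring_scheme \<Rightarrow> 'a set \<Rightarrow> 'a set set \<Rightarrow> bool" where
  "primary_decomposition R I D \<longleftrightarrow> finite D \<and> (\<forall>Q\<in>D. primary_ideal Q R) \<and>
     I = carrier R \<inter> \<Inter>D \<and> inj_on (ideal_radical R) D \<and>
     (\<forall>Q\<in>D. \<not> carrier R \<inter> \<Inter>(D - {Q}) \<subseteq> Q)"

definition isolated_primary_component ::
    "('a, 'b) ring_scheme \<Rightarrow> 'a set \<Rightarrow> 'a set \<Rightarrow> 'a set \<Rightarrow> bool" where
  "isolated_primary_component R I P Q \<longleftrightarrow> (\<exists>D. primary_decomposition R I D \<and> Q \<in> D \<and>
     ideal_radical R Q = P \<and> (\<forall>Q'\<in>D. ideal_radical R Q' \<subseteq> P \<longrightarrow> ideal_radical R Q' = P))"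

subsection \<open>Isolated roots, breadth one, multiplicity\<close>

definition isolated_root :: "nat \<Rightarrow> (nat \<Rightarrow> mpoly) \<Rightarrow> (nat \<Rightarrow> real) \<Rightarrow> bool" where
  "isolated_root n g x \<longleftrightarrow> is_root n g x \<and>
     (\<exists>\<epsilon>>0. \<forall>z. (\<forall>i<n. \<bar>z i - x i\<bar> < \<epsilon>) \<and> is_root n g z \<longrightarrow> (\<forall>i<n. z i = x i))"

text \<open>Corank one; written without subtraction so that it is not satisfied for \<open>n = 0\<close>.\<close>

definition breadth_one :: "nat \<Rightarrow> (nat \<Rightarrow> mpoly) \<Rightarrow> (nat \<Rightarrow> real) \<Rightarrow> bool" where
  "breadth_one n g x \<longleftrightarrow> vec_space.rank n (jacobian n g x) + 1 = n"

definition system_ideal :: "nat \<Rightarrow> (nat \<Rightarrow> mpoly) \<Rightarrow> mpoly set" where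
  "system_ideal n g = Idl\<^bsub>mp_ring n\<^esub> (g ` {..<n})"

definition point_ideal :: "nat \<Rightarrow> (nat \<Rightarrow> real) \<Rightarrow> mpoly set" where
  "point_ideal n x = Idl\<^bsub>mp_ring n\<^esub> ((\<lambda>i. mp_var i - mp_const (x i)) ` {..<n})"

text \<open>The dimension is that of the quotient ring over the image of the constants in it, which is
  a copy of the reals. In particular the relation forces the dimension to be finite.\<close>

definition root_multiplicity ::
    "nat \<Rightarrow> (nat \<Rightarrow> mpoly) \<Rightarrow> (nat \<Rightarrow> real) \<Rightarrow> nat \<Rightarrow> bool" where
  "root_multiplicity n g x d \<longleftrightarrow> (\<exists>Q.
     isolated_primary_component (mp_ring n) (system_ideal n g) (point_ideal n x) Q \<and>
     ring.dimension (mp_ring n Quot Q) d (range (\<lambda>c. Q +>\<^bsub>mp_ring n\<^esub> mp_const c))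
       (carrier (mp_ring n Quot Q)))"

subsection \<open>The deflated system\<close>

text \<open>The unknowns of the deflated system, in the order \<open>(x, b, a)\<close>, are \<open>x\<close> at \<open>0, \<dots>, n - 1\<close>,
  \<open>b\<^sub>\<nu>\<close> at \<open>b_index n \<nu>\<close>, and the entry of \<open>a\<^sub>k\<close> in (0-based) position \<open>j \<ge> 1\<close> at
  \<open>a_index n \<mu> k j\<close>. The index \<open>k\<close> is the paper's, ranging from 2 to \<open>\<mu>\<close>.\<close>

definition b_index :: "nat \<Rightarrow> nat \<Rightarrow> nat" where
  "b_index n \<nu> = n + \<nu>"

definition a_index :: "nat \<Rightarrow> nat \<Rightarrow> nat \<Rightarrow> nat \<Rightarrow> nat" where
  "a_index n \<mu> k j = n + (\<mu> - 1) + (k - 2) * (n - 1) + (j - 1)"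

definition a_par :: "nat \<Rightarrow> nat \<Rightarrow> nat \<Rightarrow> nat \<Rightarrow> mpoly" where
  "a_par n \<mu> k j = (if j = 0 then (if k = 2 then 1 else 0) else mp_var (a_index n \<mu> k j))"

text \<open>The smoothing parameters are polynomials, so that they can be either unknowns (in the
  deflated system) or constants (in \<open>F\<^sub>0\<close>).\<close>

definition F1 :: "nat \<Rightarrow> (nat \<Rightarrow> mpoly) \<Rightarrow> (nat \<Rightarrow> mpoly) \<Rightarrow> nat \<Rightarrow> mpoly" where
  "F1 \<mu> F b i =
     F i - (if i = 0 then \<Sum>\<nu>=0..\<mu> - 2. mp_const (1 / fact \<nu>) * b \<nu> * mp_var 0 ^ \<nu> else 0)"

definition jac_mult :: "nat \<Rightarrow> (nat \<Rightarrow> mpoly) \<Rightarrow> (nat \<Rightarrow> mpoly) \<Rightarrow> nat \<Rightarrow> mpoly" where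
  "jac_mult n H v i = (\<Sum>j<n. mp_pderiv j (H i) * v j)"

text \<open>\<open>L\<^sub>1\<close> is not defined in the paper; here it is the identity, so that \<open>F\<^sub>k = L\<^sub>k(F\<^sub>1)\<close> also
  for \<open>k = 1\<close>. For \<open>k = 2\<close> the sum, which is \<open>P\<^sub>k\<close>, is empty.\<close>

function L_op :: "nat \<Rightarrow> (nat \<Rightarrow> nat \<Rightarrow> mpoly) \<Rightarrow> (nat \<Rightarrow> mpoly) \<Rightarrow> nat \<Rightarrow> nat \<Rightarrow> mpoly" where
  "L_op n a H k = (if k < 2 then H else (\<lambda>i.
     (\<Sum>j=1..k - 2. mp_const (real j / real (k - 1)) * jac_mult n (L_op n a H (k - j)) (a (j + 1)) i)
     + jac_mult n H (a k) i))"
  by pat_completeness auto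
termination
  by (relation "Wellfounded.measure (\<lambda>(n, a, H, k). k)") auto

declare L_op.simps [simp del]

definition deflated_system :: "nat \<Rightarrow> nat \<Rightarrow> (nat \<Rightarrow> mpoly) \<Rightarrow> nat \<Rightarrow> mpoly" where
  "deflated_system n \<mu> F m =
     L_op n (a_par n \<mu>) (F1 \<mu> F (\<lambda>\<nu>. mp_var (b_index n \<nu>))) (m div n + 1) (m mod n)"

subsection \<open>Hypotheses of the verification theorem\<close>

text \<open>A box \<open>Y\<close> and an interval matrix \<open>M\<close> are given by their interval components below \<open>N\<close>.
  The preconditioner is \<open>J\<^sub>G\<close> itself, not its inverse.\<close>

definition in_box :: "nat \<Rightarrow> (nat \<Rightarrow> real) \<Rightarrow> (nat \<Rightarrow> real interval) \<Rightarrow> bool" where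
  "in_box N y Y \<longleftrightarrow> (\<forall>j<N. y j \<in>\<^sub>i Y j)"

text \<open>Component \<open>i\<close> of \<open>-J\<^sub>G(y) G(y) + (I - J\<^sub>G(y) M) Y\<close> in interval arithmetic. This agrees with
  the range over all point matrices in \<open>M\<close> and points in \<open>Y\<close>, because for fixed \<open>i\<close> every interval
  entry \<open>M\<^sub>k\<^sub>j\<close> is used once, and different coefficients of \<open>Y\<close> use different columns of \<open>M\<close>.\<close>

definition verification_operator ::
    "nat \<Rightarrow> (nat \<Rightarrow> mpoly) \<Rightarrow> (nat \<Rightarrow> real) \<Rightarrow> (nat \<Rightarrow> real interval) \<Rightarrow>
     (nat \<Rightarrow> nat \<Rightarrow> real interval) \<Rightarrow> nat \<Rightarrow> real interval" where
  "verification_operator N G y Y M i =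
     interval_of (- (\<Sum>k<N. jacobian N G y $$ (i, k) * mp_eval (G k) y)) +
     (\<Sum>j<N. (interval_of (if i = j then 1 else 0) -
               (\<Sum>k<N. interval_of (jacobian N G y $$ (i, k)) * M k j)) * Y j)"

definition verification_applicable ::
    "nat \<Rightarrow> (nat \<Rightarrow> mpoly) \<Rightarrow> (nat \<Rightarrow> real) \<Rightarrow> (nat \<Rightarrow> real interval) \<Rightarrow>
     (nat \<Rightarrow> nat \<Rightarrow> real interval) \<Rightarrow> bool" where
  "verification_applicable N G y Y M \<longleftrightarrow>
     in_box N y Y \<and>
     (\<forall>i<N. \<forall>j<N. \<forall>z. in_box N z Y \<longrightarrow> mp_eval (mp_pderiv j (G i)) z \<in>\<^sub>i M i j) \<and>
     (\<forall>i<N. set_of (verification_operator N G y Y M i) \<subseteq> interior (set_of (Y i)))"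

end

theory Submission
  imports
    Defs
    "HOL-Algebra.Ring_Divisibility"
    "HOL-Computational_Algebra.Polynomial"
begin

text \<open>
  Write \<open>F\<^sub>0\<close> for \<open>F\<^sub>1\<close> at the computed parameters \<open>b\<close>, and \<open>J\<close> for the Jacobian matrix of
  \<open>F\<^sub>0\<close> at the computed point \<open>x\<close>. The computed \<open>x\<close> and \<open>a\<close> form the polynomial arc
  \<open>\<gamma>(t) = x + a\<^sub>2 t + \<dots> + a\<^sub>\<mu> t\<^sup>\<mu>\<^sup>-\<^sup>1\<close>, whose first coordinate is \<open>x\<^sub>1 + t\<close>. The recursion for
  \<open>L\<^sub>k\<close> is the chain rule for \<open>d/dt\<close>: \<open>L\<^sub>k(H)\<close> is the coefficient of \<open>t\<^sup>k\<^sup>-\<^sup>1\<close> in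
  \<open>H(\<gamma>(t))\<close> (lemma \<open>L_op_eq_coeff\<close>). Hence \<open>G = 0\<close> says that \<open>F\<^sub>0\<close> vanishes along \<open>\<gamma>\<close> to order
  at least \<open>\<mu>\<close>.

  Differentiating this description, a vector in the kernel of \<open>J\<^sub>G\<close> is a first-order deformation
  \<open>\<Delta>\<close> of the arc that keeps the order of contact. By the inclusion of the verification theorem the
  width of the box \<open>Y\<close> strictly decreases under the interval matrix \<open>I - J\<^sub>G M\<close>, so this kernel is
  zero (\<open>verification_imp_injective_jacobian\<close>). It is tested on the deformations
  \<open>w\<^sub>1 \<gamma>'(t) + \<mu> v t\<^sup>\<mu>\<^sup>-\<^sup>1\<close>, where \<open>v = (0, w\<^sub>2, \<dots>, w\<^sub>n)\<close>: a reparametrization of \<open>\<gamma>\<close> combined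
  with a change of its last coefficient. Such a deformation keeps the contact iff
  \<open>J v + w\<^sub>1 c = 0\<close>, where \<open>c\<close> is the coefficient of \<open>t\<^sup>\<mu>\<close> in \<open>F\<^sub>0(\<gamma>(t))\<close>. So the matrix with
  columns \<open>c\<close> and columns \<open>2, \<dots>, n\<close> of \<open>J\<close> is nonsingular (\<open>contact_matrix_injective\<close>).

  The rest takes place in \<open>\<real>[X\<^sub>1, \<dots>, X\<^sub>n]\<close> (locale \<open>arc_contact\<close>). Let \<open>Q\<close> be the ideal of the
  polynomials vanishing along \<open>\<gamma>\<close> to order \<open>\<mu>\<close>, that is, the kernel of the surjection
  \<open>p \<mapsto> p(\<gamma>(t))\<close> onto \<open>\<real>[t]/(t\<^sup>\<mu>)\<close>. It has codimension \<open>\<mu>\<close>, it is primary to the maximal ideal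
  of \<open>x\<close>, and it is generated by \<open>q\<^sub>1 = (X\<^sub>1 - x\<^sub>1)\<^sup>\<mu>\<close> and the \<open>n - 1\<close> equations
  \<open>q\<^sub>j = X\<^sub>j - \<gamma>\<^sub>j(X\<^sub>1 - x\<^sub>1)\<close> of the curve.
  Since the entries of \<open>F\<^sub>0\<close> lie in \<open>Q\<close>, they are \<open>\<Sum>\<^sub>j B\<^sub>i\<^sub>j q\<^sub>j\<close> with polynomials \<open>B\<^sub>i\<^sub>j\<close>, and the value of
  \<open>B\<close> at the point \<open>x\<close> is exactly the nonsingular matrix above. With \<open>s = det B\<close>, Cramer's rule gives
  \<open>s Q \<subseteq> (F\<^sub>0) \<subseteq> Q\<close> and \<open>s(x) \<noteq> 0\<close>. From this follow all three claims. Where \<open>s \<noteq> 0\<close>, the roots of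
  \<open>F\<^sub>0\<close> are those of \<open>Q\<close>, which has only the root \<open>x\<close>. The columns \<open>2, \<dots>, n\<close> of \<open>J\<close> are
  independent, while \<open>J \<gamma>'(0) = 0\<close> with \<open>\<gamma>'(0) \<noteq> 0\<close>. Finally \<open>(F\<^sub>0) = Q \<inter> ((F\<^sub>0) + (s))\<close>,
  and the primary components of the second ideal contain \<open>s\<close>, so that \<open>Q\<close> is the component at \<open>x\<close>
  (\<open>isolated_primary_componentI\<close>). That the second ideal has a primary decomposition
  is the theorem of Lasker and Noether, which rests on Hilbert's basis theorem.\<close>

section \<open>Multivariate polynomials, substitutions and derivations\<close>

lemma poly_mapping_sum_single:
  fixes p :: "'a \<Rightarrow>\<^sub>0 'b::comm_monoid_add"
  shows "p = (\<Sum>m\<in>Poly_Mapping.keys p. Poly_Mapping.single m (Poly_Mapping.lookup p m))"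
  by (rule poly_mapping_eqI)
    (simp add: lookup_sum lookup_single when_def in_keys_iff)

definition monom_val :: "(nat \<Rightarrow> 'a::comm_ring_1) \<Rightarrow> (nat \<Rightarrow>\<^sub>0 nat) \<Rightarrow> 'a" where
  "monom_val g m = (\<Prod>i\<in>Poly_Mapping.keys m. g i ^ Poly_Mapping.lookup m i)"

definition mp_subst ::
    "(real \<Rightarrow> 'a::comm_ring_1) \<Rightarrow> (nat \<Rightarrow> 'a) \<Rightarrow> mpoly \<Rightarrow> 'a" where
  "mp_subst C g p =
     (\<Sum>m\<in>Poly_Mapping.keys p. C (Poly_Mapping.lookup p m) * monom_val g m)"

lemma monom_val_superset:
  assumes "finite A" "Poly_Mapping.keys m \<subseteq> A"
  shows "monom_val g m = (\<Prod>i\<in>A. g i ^ Poly_Mapping.lookup m i)"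
  unfolding monom_val_def
  by (rule prod.mono_neutral_left) (use assms in \<open>auto simp: in_keys_iff\<close>)

lemma monom_val_add: "monom_val g (m + m') = monom_val g m * monom_val g m'"
proof -
  let ?A = "Poly_Mapping.keys m \<union> Poly_Mapping.keys m'"
  have "monom_val g (m + m') = (\<Prod>i\<in>?A. g i ^ Poly_Mapping.lookup (m + m') i)"
    by (rule monom_val_superset) (use keys_add[of m m'] in auto)
  also have "\<dots> = (\<Prod>i\<in>?A. g i ^ Poly_Mapping.lookup m i) * (\<Prod>i\<in>?A. g i ^ Poly_Mapping.lookup m' i)"
    by (simp add: lookup_add power_add prod.distrib)
  also have "\<dots> = monom_val g m * monom_val g m'"
    by (simp add: monom_val_superset[symmetric])
  finally show ?thesis .
qed

lemma monom_val_0 [simp]: "monom_val g 0 = 1"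
  by (simp add: monom_val_def)

lemma monom_val_single [simp]: "monom_val g (Poly_Mapping.single i k) = g i ^ k"
  by (cases "k = 0") (simp_all add: monom_val_def)

locale mp_substitution = C: comm_ring_hom C for C :: "real \<Rightarrow> 'a::comm_ring_1" +
  fixes g :: "nat \<Rightarrow> 'a"
begin

lemma subst_single: "mp_subst C g (Poly_Mapping.single m c) = C c * monom_val g m"
  by (simp add: mp_subst_def C.hom_zero)

lemma subst_add: "mp_subst C g (p + q) = mp_subst C g p + mp_subst C g q"
  unfolding mp_subst_def
  by (rule setsum_keys_plus_distrib) (simp_all add: C.hom_zero C.hom_add algebra_simps)

lemma subst_sum: "mp_subst C g (\<Sum>x\<in>A. f x) = (\<Sum>x\<in>A. mp_subst C g (f x))"
  by (induction A rule: infinite_finite_induct) (auto simp: subst_add, auto simp: mp_subst_def)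

lemma subst_mult: "mp_subst C g (p * q) = mp_subst C g p * mp_subst C g q"
proof -
  let ?s = "\<lambda>r m. Poly_Mapping.single m (Poly_Mapping.lookup r m) :: mpoly"
  have "p * q = (\<Sum>m\<in>Poly_Mapping.keys p. \<Sum>m'\<in>Poly_Mapping.keys q. ?s p m * ?s q m')"
    by (subst poly_mapping_sum_single[of p], subst poly_mapping_sum_single[of q])
      (simp add: sum_product)
  then show ?thesis
    by (subst (2) poly_mapping_sum_single[of p], subst (2) poly_mapping_sum_single[of q])
      (simp add: subst_sum subst_single mult_single monom_val_add C.hom_mult sum_product ac_simps)
qed

sublocale comm_ring_hom "mp_subst C g"
proof
  show "mp_subst C g 1 = 1"
    by (metis subst_single single_one monom_val_0 C.hom_one mult_1)
  show "mp_subst C g 0 = 0" by (simp add: mp_subst_def)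
qed (fact subst_add subst_mult)+

lemma subst_const: "mp_subst C g (mp_const c) = C c"
  by (simp add: mp_const_def subst_single)

lemma subst_var: "mp_subst C g (mp_var i) = g i"
  by (simp add: mp_var_def subst_single C.hom_one)

end

lemma mp_subst_cong:
  assumes "\<And>i. i \<in> mp_vars p \<Longrightarrow> g i = h i"
  shows "mp_subst C g p = mp_subst C h p"
  unfolding mp_subst_def monom_val_def
proof (intro sum.cong refl arg_cong2[where f = "(*)"] prod.cong)
  fix m i assume "m \<in> Poly_Mapping.keys p" "i \<in> Poly_Mapping.keys m"
  then have "i \<in> mp_vars p" by (auto simp: mp_vars_def)
  then show "g i ^ Poly_Mapping.lookup m i = h i ^ Poly_Mapping.lookup m i"
    by (simp add: assms)
qed

lemma comm_ring_hom_id: "comm_ring_hom (\<lambda>x. x)"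
  by unfold_locales auto

lemma mp_eval_eq_subst: "mp_eval p x = mp_subst (\<lambda>c. c) x p"
  by (simp add: mp_eval_def mp_subst_def monom_val_def)

interpretation mp_eval: comm_ring_hom "\<lambda>p. mp_eval p x" for x
proof -
  interpret mp_substitution "\<lambda>c. c" x
    by (rule mp_substitution.intro) (rule comm_ring_hom_id)
  show "comm_ring_hom (\<lambda>p. mp_eval p x)"
    unfolding mp_eval_eq_subst by (rule comm_ring_hom_axioms)
qed

lemma mp_eval_const [simp]: "mp_eval (mp_const c) x = c"
  by (simp add: mp_eval_def mp_const_def)

lemma mp_eval_var [simp]: "mp_eval (mp_var i) x = x i"
  by (simp add: mp_eval_def mp_var_def)

lemma mp_eval_cong: "(\<And>i. i \<in> mp_vars p \<Longrightarrow> x i = z i) \<Longrightarrow> mp_eval p x = mp_eval p z"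
  unfolding mp_eval_eq_subst by (rule mp_subst_cong)

interpretation mp_const: comm_ring_hom mp_const
  by unfold_locales (simp_all add: mp_const_def single_add mult_single)

lemma mp_vars_const [simp]: "mp_vars (mp_const c) = {}"
  by (simp add: mp_vars_def mp_const_def)

lemma mp_vars_var [simp]: "mp_vars (mp_var i) = {i}"
  by (simp add: mp_vars_def mp_var_def)

lemma mp_vars_0 [simp]: "mp_vars 0 = {}" and mp_vars_1 [simp]: "mp_vars 1 = {}"
  by (simp_all add: mp_vars_def)

lemma mp_vars_add: "mp_vars (p + q) \<subseteq> mp_vars p \<union> mp_vars q"
  using keys_add[of p q] by (auto simp: mp_vars_def)

lemma mp_vars_mult: "mp_vars (p * q) \<subseteq> mp_vars p \<union> mp_vars q"
proof
  fix i assume "i \<in> mp_vars (p * q)"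
  then obtain m m' where "m \<in> Poly_Mapping.keys p" "m' \<in> Poly_Mapping.keys q"
      "i \<in> Poly_Mapping.keys (m + m')"
    using keys_mult[of p q] by (fastforce simp: mp_vars_def)
  then show "i \<in> mp_vars p \<union> mp_vars q"
    using keys_add[of m m'] by (auto simp: mp_vars_def)
qed

lemma mp_vars_uminus [simp]: "mp_vars (- p) = mp_vars p"
  by (simp add: mp_vars_def in_keys_iff set_eq_iff)

lemma mp_vars_subset_add: "mp_vars p \<subseteq> V \<Longrightarrow> mp_vars q \<subseteq> V \<Longrightarrow> mp_vars (p + q) \<subseteq> V"
  using mp_vars_add[of p q] by blast

lemma mp_vars_subset_mult: "mp_vars p \<subseteq> V \<Longrightarrow> mp_vars q \<subseteq> V \<Longrightarrow> mp_vars (p * q) \<subseteq> V"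
  using mp_vars_mult[of p q] by blast

lemma mp_vars_subset_diff: "mp_vars p \<subseteq> V \<Longrightarrow> mp_vars q \<subseteq> V \<Longrightarrow> mp_vars (p - q) \<subseteq> V"
  using mp_vars_subset_add[of p V "- q"] by simp

lemma mp_vars_subset_sum: "(\<And>i. i \<in> A \<Longrightarrow> mp_vars (f i) \<subseteq> V) \<Longrightarrow> mp_vars (\<Sum>i\<in>A. f i) \<subseteq> V"
  by (induction A rule: infinite_finite_induct) (simp_all add: mp_vars_subset_add)

lemma mp_vars_subset_power: "mp_vars p \<subseteq> V \<Longrightarrow> mp_vars (p ^ k) \<subseteq> V"
  by (induction k) (simp_all add: mp_vars_subset_mult)

lemma single_eq_monom_val:
  "Poly_Mapping.single m c = mp_const c * monom_val mp_var m"
proof -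
  have one: "Poly_Mapping.single (\<Sum>i\<in>A. Poly_Mapping.single i (k i)) 1 =
      (\<Prod>i\<in>A. mp_var i ^ k i)" if "finite A" for A :: "nat set" and k :: "nat \<Rightarrow> nat"
    using that
  proof (induction A)
    case (insert i A)
    have "Poly_Mapping.single (Poly_Mapping.single i (k i)) 1 = mp_var i ^ k i"
    proof (induction "k i")
      case 0 then show ?case by simp
    next
      case (Suc n)
      have "Poly_Mapping.single (Poly_Mapping.single i n) (1::real) = mp_var i ^ n" for n
      proof (induction n)
        case (Suc n)
        have "Poly_Mapping.single (Poly_Mapping.single i (Suc n)) (1::real) =
            mp_var i * Poly_Mapping.single (Poly_Mapping.single i n) 1"
          unfolding mp_var_def mult_single by (simp flip: single_add)
        then show ?case using Suc by simp
      qed simp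
      then show ?case by blast
    qed
    moreover have "Poly_Mapping.single (a + b) (1::real) =
        Poly_Mapping.single a 1 * Poly_Mapping.single b 1" for a b :: "nat \<Rightarrow>\<^sub>0 nat"
      by (simp add: mult_single)
    ultimately show ?case using insert by simp
  qed simp
  have "Poly_Mapping.single m (1::real) = monom_val mp_var m"
    using one[OF finite_keys[of m], of "Poly_Mapping.lookup m"]
    by (simp flip: poly_mapping_sum_single add: monom_val_def)
  moreover have "Poly_Mapping.single m c = mp_const c * Poly_Mapping.single m 1"
    by (simp add: mp_const_def mult_single)
  ultimately show ?thesis by simp
qed

text \<open>The set \<open>V\<close> makes this a structural induction over \<open>\<real>[V]\<close>: all intermediate polynomials use
  variables from \<open>V\<close> only.\<close>

lemma mp_induct [consumes 1, case_names const var add mult]: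
  assumes vars: "mp_vars p \<subseteq> V"
    and const: "\<And>c. P (mp_const c)"
    and var: "\<And>i. i \<in> V \<Longrightarrow> P (mp_var i)"
    and add: "\<And>p q. mp_vars p \<subseteq> V \<Longrightarrow> mp_vars q \<subseteq> V \<Longrightarrow> P p \<Longrightarrow> P q \<Longrightarrow> P (p + q)"
    and mult: "\<And>p q. mp_vars p \<subseteq> V \<Longrightarrow> mp_vars q \<subseteq> V \<Longrightarrow> P p \<Longrightarrow> P q \<Longrightarrow> P (p * q)"
  shows "P p"
proof -
  let ?P = "\<lambda>p. mp_vars p \<subseteq> V \<and> P p"
  have c: "?P (mp_const c)" for c by (simp add: const)
  have a: "?P (p + q)" if "?P p" "?P q" for p q
    using that add[of p q] mp_vars_add[of p q] by blast
  have m: "?P (p * q)" if "?P p" "?P q" for p q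
    using that mult[of p q] mp_vars_mult[of p q] by blast
  have p: "?P (mp_var i ^ k)" if "i \<in> V" for i k
    using c[of 1] by (induction k) (auto simp: mp_const.hom_one that var intro!: m)
  have pr: "?P (\<Prod>i\<in>A. mp_var i ^ f i)" if "A \<subseteq> V" for A and f :: "nat \<Rightarrow> nat"
    using that
    by (induction A rule: infinite_finite_induct)
      (use c[of 1] in \<open>simp_all add: mp_const.hom_one m p\<close>)
  have s: "?P (\<Sum>m\<in>A. f m)" if "\<And>m. m \<in> A \<Longrightarrow> ?P (f m)" for A and f :: "(nat \<Rightarrow>\<^sub>0 nat) \<Rightarrow> mpoly"
    using that
    by (induction A rule: infinite_finite_induct)
      (use c[of 0] in \<open>simp_all add: mp_const.hom_zero a\<close>)
  have "?P (\<Sum>m\<in>Poly_Mapping.keys p. mp_const (Poly_Mapping.lookup p m) * monom_val mp_var m)"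
    unfolding monom_val_def by (intro s m c pr) (use vars in \<open>auto simp: mp_vars_def\<close>)
  then show ?thesis
    by (simp flip: poly_mapping_sum_single single_eq_monom_val)
qed

lemma mp_pderiv_single:
  "mp_pderiv i (Poly_Mapping.single m c) =
     Poly_Mapping.single (m - Poly_Mapping.single i 1) (real (Poly_Mapping.lookup m i) * c)"
  by (simp add: mp_pderiv_def)

lemma mp_pderiv_add: "mp_pderiv i (p + q) = mp_pderiv i p + mp_pderiv i q"
  unfolding mp_pderiv_def
  by (rule setsum_keys_plus_distrib) (simp_all add: algebra_simps flip: single_add)

lemma mp_pderiv_diff: "mp_pderiv i (p - q) = mp_pderiv i p - mp_pderiv i q"
  using mp_pderiv_add[of i "p - q" q] by (simp add: eq_diff_eq)

lemma mp_pderiv_0 [simp]: "mp_pderiv i 0 = 0"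
  by (simp add: mp_pderiv_def)

lemma mp_pderiv_sum: "mp_pderiv i (\<Sum>x\<in>A. f x) = (\<Sum>x\<in>A. mp_pderiv i (f x))"
  by (induction A rule: infinite_finite_induct) (auto simp: mp_pderiv_add)

lemma mp_pderiv_const [simp]: "mp_pderiv i (mp_const c) = 0"
  by (simp add: mp_const_def mp_pderiv_single)

lemma mp_pderiv_var: "mp_pderiv i (mp_var j) = (if i = j then 1 else 0)"
  by (simp add: mp_var_def mp_pderiv_single lookup_single)

lemma mp_pderiv_mult: "mp_pderiv i (p * q) = p * mp_pderiv i q + mp_pderiv i p * q"
proof -
  let ?s = "\<lambda>r m. Poly_Mapping.single m (Poly_Mapping.lookup r m) :: mpoly"
  have shift: "m + m' - Poly_Mapping.single i 1 = m + (m' - Poly_Mapping.single i 1)"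
    if "Poly_Mapping.lookup m' i \<noteq> 0" for m m' :: "nat \<Rightarrow>\<^sub>0 nat"
    by (rule poly_mapping_eqI) (use that in \<open>auto simp: lookup_add lookup_minus lookup_single when_def\<close>)
  have single: "mp_pderiv i (Poly_Mapping.single m c * Poly_Mapping.single m' c') =
      Poly_Mapping.single m c * mp_pderiv i (Poly_Mapping.single m' c') +
      mp_pderiv i (Poly_Mapping.single m c) * Poly_Mapping.single m' c'" for m m' c c'
    using shift[of m' m] shift[of m m']
    by (cases "Poly_Mapping.lookup m i = 0"; cases "Poly_Mapping.lookup m' i = 0")
      (auto simp: mult_single mp_pderiv_single lookup_add algebra_simps simp flip: single_add)
  have pq: "p * q = (\<Sum>m\<in>Poly_Mapping.keys p. \<Sum>m'\<in>Poly_Mapping.keys q. ?s p m * ?s q m')"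
    by (subst poly_mapping_sum_single[of p], subst poly_mapping_sum_single[of q])
      (simp add: sum_product)
  have "mp_pderiv i (p * q) =
      (\<Sum>m\<in>Poly_Mapping.keys p. ?s p m) * mp_pderiv i (\<Sum>m'\<in>Poly_Mapping.keys q. ?s q m') +
      mp_pderiv i (\<Sum>m\<in>Poly_Mapping.keys p. ?s p m) * (\<Sum>m'\<in>Poly_Mapping.keys q. ?s q m')"
    unfolding pq by (simp add: mp_pderiv_sum single sum.distrib sum_product)
  then show ?thesis
    by (simp flip: poly_mapping_sum_single)
qed

lemma mp_vars_pderiv:
  assumes "mp_vars p \<subseteq> V" shows "mp_vars (mp_pderiv i p) \<subseteq> V"
  using assms
proof (induction rule: mp_induct)
  case (add p q)
  then show ?case using mp_vars_add by (force simp: mp_pderiv_add)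
next
  case (mult p q)
  have "mp_vars (mp_pderiv i (p * q)) \<subseteq> mp_vars (p * mp_pderiv i q) \<union> mp_vars (mp_pderiv i p * q)"
    unfolding mp_pderiv_mult by (rule mp_vars_add)
  also have "\<dots> \<subseteq> V"
    using mult mp_vars_mult[of p "mp_pderiv i q"] mp_vars_mult[of "mp_pderiv i p" q] by blast
  finally show ?case .
next
  case (var j)
  show ?case by (simp add: mp_pderiv_var mp_vars_def)
qed (simp add: mp_vars_def)

lemma mp_pderiv_eq_0:
  assumes "i \<notin> mp_vars p" shows "mp_pderiv i p = 0"
proof -
  have "mp_vars p \<subseteq> - {i}" using assms by auto
  then show ?thesis
    by (induction rule: mp_induct) (auto simp: mp_pderiv_var mp_pderiv_add mp_pderiv_mult)
qed

text \<open>A derivation along a homomorphism \<open>\<phi>\<close> is determined by its values on the variables. Applied to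
  \<open>d/dt\<close>, to derivatives of coefficients and to directional derivatives, this single statement
  supplies every form of the chain rule below.\<close>

lemma derivation_chain_rule:
  fixes \<phi> D :: "mpoly \<Rightarrow> 'a::comm_ring_1"
  assumes "comm_ring_hom \<phi>"
    and add: "\<And>p q. D (p + q) = D p + D q"
    and mult: "\<And>p q. D (p * q) = \<phi> p * D q + D p * \<phi> q"
    and const: "\<And>c. D (mp_const c) = 0"
    and "mp_vars p \<subseteq> V" "finite V"
  shows "D p = (\<Sum>l\<in>V. \<phi> (mp_pderiv l p) * D (mp_var l))"
proof -
  interpret comm_ring_hom \<phi> by fact
  show ?thesis
    using assms(5)
  proof (induction rule: mp_induct)
    case (const c) then show ?case by (simp add: assms(4) hom_zero)
  next
    case (var i) 
    have "(\<Sum>l\<in>V. \<phi> (mp_pderiv l (mp_var i)) * D (mp_var l)) =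
        (\<Sum>l\<in>V. if l = i then D (mp_var l) else 0)"
      by (intro sum.cong) (auto simp: mp_pderiv_var hom_zero hom_one)
    then show ?case using var assms(6) by simp
  next
    case (add p q)
    then show ?case by (simp add: assms(2) mp_pderiv_add hom_add distrib_right sum.distrib)
  next
    case (mult p q)
    have "D (p * q) = \<phi> p * (\<Sum>l\<in>V. \<phi> (mp_pderiv l q) * D (mp_var l)) +
        (\<Sum>l\<in>V. \<phi> (mp_pderiv l p) * D (mp_var l)) * \<phi> q"
      using mult by (simp add: assms(3))
    then show ?case
      by (simp add: mp_pderiv_mult hom_add hom_mult sum_distrib_left sum_distrib_right
          algebra_simps sum.distrib)
  qed
qed

lemma mp_hom_eqI:
  assumes "comm_ring_hom \<phi>" "comm_ring_hom \<psi>" "mp_vars p \<subseteq> V"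
    and const: "\<And>c. \<phi> (mp_const c) = \<psi> (mp_const c)"
    and var: "\<And>i. i \<in> V \<Longrightarrow> \<phi> (mp_var i) = \<psi> (mp_var i)"
  shows "\<phi> p = \<psi> p"
proof -
  interpret \<phi>: comm_ring_hom \<phi> by fact
  interpret \<psi>: comm_ring_hom \<psi> by fact
  from assms(3) show ?thesis
    by (induction rule: mp_induct) (auto simp: const var \<phi>.hom_add \<psi>.hom_add \<phi>.hom_mult \<psi>.hom_mult)
qed

section \<open>Hilbert's basis theorem\<close>

text \<open>A subring of a type-level ring as a ring record. Subrings of one type are needed because the
  induction on the number of variables cannot change the type.\<close>

definition subset_ring :: "'a::comm_ring_1 set \<Rightarrow> 'a ring" where
  "subset_ring S = \<lparr>carrier = S, monoid.mult = (*), one = 1, zero = 0, add = (+)\<rparr>"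

definition closed_subring :: "'a::comm_ring_1 set \<Rightarrow> bool" where
  "closed_subring S \<longleftrightarrow> 1 \<in> S \<and> (\<forall>x\<in>S. - x \<in> S) \<and> (\<forall>x\<in>S. \<forall>y\<in>S. x + y \<in> S \<and> x * y \<in> S)"

lemma subset_ring_simps [simp]:
  "carrier (subset_ring S) = S" "monoid.mult (subset_ring S) = (*)" "one (subset_ring S) = 1"
  "zero (subset_ring S) = 0" "add (subset_ring S) = (+)"
  by (simp_all add: subset_ring_def)

lemma closed_subringD:
  assumes "closed_subring S"
  shows "1 \<in> S" "0 \<in> S" "x \<in> S \<Longrightarrow> - x \<in> S" "x \<in> S \<Longrightarrow> y \<in> S \<Longrightarrow> x + y \<in> S"
    "x \<in> S \<Longrightarrow> y \<in> S \<Longrightarrow> x - y \<in> S" "x \<in> S \<Longrightarrow> y \<in> S \<Longrightarrow> x * y \<in> S"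
proof -
  show *: "1 \<in> S" "x \<in> S \<Longrightarrow> - x \<in> S" "x \<in> S \<Longrightarrow> y \<in> S \<Longrightarrow> x + y \<in> S"
      "x \<in> S \<Longrightarrow> y \<in> S \<Longrightarrow> x * y \<in> S" for x y
    using assms by (auto simp: closed_subring_def)
  show "0 \<in> S" using *(3)[OF *(1) *(2)[OF *(1)]] by simp
  show "x \<in> S \<Longrightarrow> y \<in> S \<Longrightarrow> x - y \<in> S"
    using *(3)[of x "- y"] *(2)[of y] by simp
qed

lemma closed_subring_sum:
  "closed_subring S \<Longrightarrow> (\<And>i. i \<in> A \<Longrightarrow> f i \<in> S) \<Longrightarrow> (\<Sum>i\<in>A. f i) \<in> S"
  by (induction A rule: infinite_finite_induct) (auto intro: closed_subringD)

lemma closed_subring_prod: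
  "closed_subring S \<Longrightarrow> (\<And>i. i \<in> A \<Longrightarrow> f i \<in> S) \<Longrightarrow> (\<Prod>i\<in>A. f i) \<in> S"
  by (induction A rule: infinite_finite_induct) (auto intro: closed_subringD)

lemma closed_subring_power: "closed_subring S \<Longrightarrow> x \<in> S \<Longrightarrow> x ^ k \<in> S"
  by (induction k) (auto intro: closed_subringD)

lemma cring_subset_ring:
  assumes S: "closed_subring S" shows "cring (subset_ring S)"
proof (rule cringI)
  show "abelian_group (subset_ring S)"
    by (rule abelian_groupI)
      (use closed_subringD[OF S] in \<open>auto simp: add.assoc add.commute intro!: bexI[of _ "- _"]\<close>)
  show "Group.comm_monoid (subset_ring S)"
    by (rule comm_monoidI) (use closed_subringD[OF S] in \<open>auto simp: mult.assoc mult.commute\<close>)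
qed (auto simp: algebra_simps)

lemma ideal_subset_ring_iff:
  assumes S: "closed_subring S"
  shows "ideal I (subset_ring S) \<longleftrightarrow>
    I \<subseteq> S \<and> 0 \<in> I \<and> (\<forall>x\<in>I. \<forall>y\<in>I. x + y \<in> I) \<and> (\<forall>a\<in>S. \<forall>x\<in>I. a * x \<in> I)"
proof
  interpret cring "subset_ring S" by (rule cring_subset_ring[OF S])
  {
    assume "ideal I (subset_ring S)"
    then interpret ideal I "subset_ring S" .
    show "I \<subseteq> S \<and> 0 \<in> I \<and> (\<forall>x\<in>I. \<forall>y\<in>I. x + y \<in> I) \<and> (\<forall>a\<in>S. \<forall>x\<in>I. a * x \<in> I)"
      using a_subset zero_closed a_closed I_l_closed by auto
  next
    assume I: "I \<subseteq> S \<and> 0 \<in> I \<and> (\<forall>x\<in>I. \<forall>y\<in>I. x + y \<in> I) \<and> (\<forall>a\<in>S. \<forall>x\<in>I. a * x \<in> I)"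
    have neg: "- x \<in> I" if "x \<in> I" for x
      using I that closed_subringD(3)[OF S closed_subringD(1)[OF S]] by fastforce
    have inv: "\<ominus>\<^bsub>subset_ring S\<^esub> x = - x" if "x \<in> I" for x
    proof -
      have "x \<in> S" "- x \<in> S" using I that neg by auto
      then show ?thesis using minus_equality[of "- x" x] by simp
    qed
    show "ideal I (subset_ring S)"
    proof (rule idealI)
      show "ring (subset_ring S)" by (rule ring_axioms)
      show "subgroup I (add_monoid (subset_ring S))"
        by (rule add.subgroupI) (use I neg inv in \<open>auto simp: a_inv_def\<close>)
    next
      fix a x assume "a \<in> I" "x \<in> carrier (subset_ring S)"
      then have "x * a \<in> I" using I by auto
      then show "x \<otimes>\<^bsub>subset_ring S\<^esub> a \<in> I" "a \<otimes>\<^bsub>subset_ring S\<^esub> x \<in> I"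
        by (simp_all add: mult.commute)
    qed
  }
qed

text \<open>The ascending chain condition for the ideals generated by initial segments of a sequence.\<close>

lemma noetherian_sequence:
  assumes "noetherian_ring R" "\<And>k::nat. a k \<in> carrier R"
  obtains k where "a k \<in> Idl\<^bsub>R\<^esub> (a ` {..<k})"
proof -
  interpret noetherian_ring R by fact
  let ?I = "\<lambda>k. Idl\<^bsub>R\<^esub> (a ` {..<k})"
  have sub: "a ` {..<k} \<subseteq> carrier R" for k using assms(2) by auto
  have mono: "?I j \<subseteq> ?I k" if "j \<le> k" for j k
  proof (rule genideal_minimal[OF genideal_ideal[OF sub]])
    have "a ` {..<j} \<subseteq> a ` {..<k}" using that by auto
    then show "a ` {..<j} \<subseteq> ?I k" using genideal_self[OF sub[of k]] by blast
  qed
  have "subset.chain {I. ideal I R} (range ?I)"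
    unfolding pred_on.chain_def
  proof (intro conjI ballI)
    show "range ?I \<subseteq> {I. ideal I R}" using genideal_ideal[OF sub] by auto
    fix X Y assume "X \<in> range ?I" "Y \<in> range ?I"
    then obtain j k where "X = ?I j" "Y = ?I k" by blast
    then show "(\<subset>)\<^sup>=\<^sup>= X Y \<or> (\<subset>)\<^sup>=\<^sup>= Y X"
      using mono[of j k] mono[of k j] by (cases "j \<le> k") auto
  qed
  from ideal_chain_is_trivial[OF _ this] obtain k where k: "(\<Union>j. ?I j) = ?I k" by auto
  have "a k \<in> ?I (Suc k)" using genideal_self[OF sub[of "Suc k"]] by auto
  with k that show thesis by blast
qed

text \<open>If an ideal is not finitely generated, choose successively elements of minimal degree outside the
  ideal generated by the earlier ones. By the ascending chain condition in \<open>S\<close>, some leading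
  coefficient lies in the ideal generated by the earlier leading coefficients; cancelling the
  leading term of that element contradicts the minimality of its degree.\<close>

theorem hilbert_basis:
  fixes S :: "'a::comm_ring_1 set"
  assumes S: "closed_subring S" and noeth: "noetherian_ring (subset_ring S)"
  defines "P \<equiv> {p. \<forall>i. coeff p i \<in> S}"
  shows "closed_subring P \<and> noetherian_ring (subset_ring P)"
proof
  note S' = closed_subringD[OF S]
  show P: "closed_subring P"
    unfolding closed_subring_def P_def
    by (auto simp: coeff_mult intro!: S' closed_subring_sum[OF S])
  note P' = closed_subringD[OF P]
  interpret S: cring "subset_ring S" by (rule cring_subset_ring[OF S])
  interpret P: cring "subset_ring P" by (rule cring_subset_ring[OF P])
  show "noetherian_ring (subset_ring P)"
  proof (rule P.noetherian_ringI, rule ccontr)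
    fix I assume I: "ideal I (subset_ring P)"
      and not_fg: "\<not> (\<exists>A\<subseteq>carrier (subset_ring P). finite A \<and> I = Idl\<^bsub>subset_ring P\<^esub> A)"
    let ?Idl = "\<lambda>A. Idl\<^bsub>subset_ring P\<^esub> A"
    note I' = I[unfolded ideal_subset_ring_iff[OF P]]
    \<comment> \<open>\<open>r\<close> is an admissible choice after \<open>f 0, \<dots>, f (k - 1)\<close>\<close>
    let ?R = "\<lambda>f (k::nat) r. r \<in> I - ?Idl (f ` {..<k}) \<and>
        (\<forall>h\<in>I - ?Idl (f ` {..<k}). degree r \<le> degree h)"
    have "\<exists>f. \<forall>k. ?R f k (f k)"
    proof (rule dependent_wellorder_choice)
      fix r and f g :: "nat \<Rightarrow> 'a poly" and x :: nat
      assume "\<And>y. y < x \<Longrightarrow> f y = g y"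
      then have "f ` {..<x} = g ` {..<x}" by auto
      then show "?R f x r = ?R g x r" by simp
    next
      fix x :: nat and f assume f: "\<And>y. y < x \<Longrightarrow> ?R f y (f y)"
      then have "f ` {..<x} \<subseteq> I" by auto
      then have "?Idl (f ` {..<x}) \<subseteq> I" by (rule P.genideal_minimal[OF I])
      moreover have "?Idl (f ` {..<x}) \<noteq> I"
        using not_fg \<open>f ` {..<x} \<subseteq> I\<close> I' by (metis finite_imageI finite_lessThan subset_ring_simps(1) subset_trans)
      ultimately have "\<exists>h. h \<in> I - ?Idl (f ` {..<x})" by blast
      from ex_has_least_nat[where P = "\<lambda>h. h \<in> I - ?Idl (f ` {..<x})" and m = degree] this
      show "\<exists>r. ?R f x r" by blast
    qed
    then obtain f :: "nat \<Rightarrow> 'a poly" where f: "\<And>k. f k \<in> I" "\<And>k. f k \<notin> ?Idl (f ` {..<k})"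
        "\<And>k h. h \<in> I \<Longrightarrow> h \<notin> ?Idl (f ` {..<k}) \<Longrightarrow> degree (f k) \<le> degree h"
      by blast
    define d where "d k = degree (f k)" for k
    have fP: "f k \<in> P" for k using f(1) I' by blast
    have sub: "f ` {..<k} \<subseteq> P" for k using fP by auto
    have J_ideal: "ideal (?Idl (f ` {..<k})) (subset_ring P)" for k
      using P.genideal_ideal sub by simp
    have J: "f ` {..<k} \<subseteq> ?Idl (f ` {..<k})" for k
      using P.genideal_self sub by simp
    have d_mono: "d i \<le> d k" if "i < k" for i k
      unfolding d_def
    proof (rule f(3)[OF f(1)])
      have "?Idl (f ` {..<i}) \<subseteq> ?Idl (f ` {..<k})"
      proof (rule P.genideal_minimal[OF J_ideal])
        have "f ` {..<i} \<subseteq> f ` {..<k}" using that by (intro image_mono) (use that in simp)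
        then show "f ` {..<i} \<subseteq> ?Idl (f ` {..<k})" using J[of k] by blast
      qed
      then show "f k \<notin> ?Idl (f ` {..<i})" using f(2) by blast
    qed
    define a where "a k = coeff (f k) (d k)" for k
    have "a k \<in> carrier (subset_ring S)" for k
      using fP[of k] by (simp add: a_def P_def)
    then obtain k where k: "a k \<in> Idl\<^bsub>subset_ring S\<^esub> (a ` {..<k})"
      using noetherian_sequence[OF noeth] by blast
    define J where "J = ?Idl (f ` {..<k})"
    have Ji: "J \<subseteq> P" "0 \<in> J" "\<And>x y. x \<in> J \<Longrightarrow> y \<in> J \<Longrightarrow> x + y \<in> J"
        "\<And>a x. a \<in> P \<Longrightarrow> x \<in> J \<Longrightarrow> a * x \<in> J"
      using J_ideal[of k] unfolding ideal_subset_ring_iff[OF P] J_def by auto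
    have JI: "J \<subseteq> I" unfolding J_def by (rule P.genideal_minimal[OF I]) (use f(1) in auto)
    \<comment> \<open>the coefficients in degree \<open>d k\<close> of the elements of \<open>J\<close> of degree at most \<open>d k\<close>; multiplying by powers of the variable shows that they include the earlier leading coefficients\<close>
    let ?L = "{c \<in> S. \<exists>g\<in>J. degree g \<le> d k \<and> coeff g (d k) = c}"
    have "ideal ?L (subset_ring S)"
      unfolding ideal_subset_ring_iff[OF S]
    proof (intro conjI ballI)
      show "0 \<in> ?L" using Ji(2) S' by (auto intro!: bexI[of _ 0])
    next
      fix x y assume "x \<in> ?L" "y \<in> ?L"
      then obtain g h where "g \<in> J" "degree g \<le> d k" "coeff g (d k) = x" "x \<in> S"
          "h \<in> J" "degree h \<le> d k" "coeff h (d k) = y" "y \<in> S" by blast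
      then show "x + y \<in> ?L" using S'
        by (auto intro!: bexI[of _ "g + h"] Ji(3) degree_add_le)
    next
      fix c x assume "c \<in> S" "x \<in> ?L"
      then obtain g where g: "g \<in> J" "degree g \<le> d k" "coeff g (d k) = x" "x \<in> S" by blast
      have "[:c:] \<in> P" using \<open>c \<in> S\<close> S' by (auto simp: P_def coeff_pCons split: nat.splits)
      then have "[:c:] * g \<in> J" using g by (intro Ji(4))
      moreover have "degree ([:c:] * g) \<le> d k" using g(2) degree_smult_le[of c g] by simp
      moreover have "coeff ([:c:] * g) (d k) = c * x" using g(3) by simp
      moreover have "c * x \<in> S" using \<open>c \<in> S\<close> g(4) by (rule S')
      ultimately show "c * x \<in> ?L" by blast
    qed auto
    moreover have "a ` {..<k} \<subseteq> ?L"
    proof safe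
      fix i assume i: "i < k"
      have "monom 1 (d k - d i) \<in> P" using S' by (auto simp: P_def)
      then have "monom 1 (d k - d i) * f i \<in> J"
        using J[of k] i by (intro Ji(4)) (auto simp: J_def)
      moreover have "degree (monom 1 (d k - d i) * f i) \<le> d k"
        using degree_mult_le[of "monom 1 (d k - d i)" "f i"] degree_monom_le[of "1::'a" "d k - d i"]
          d_mono[OF i] by (simp add: d_def)
      moreover have "coeff (monom 1 (d k - d i) * f i) (d k) = a i"
        using d_mono[OF i] by (simp add: coeff_monom_mult a_def)
      ultimately show "\<exists>g\<in>J. degree g \<le> d k \<and> coeff g (d k) = a i" by blast
      show "a i \<in> S" using fP[of i] by (simp add: a_def P_def)
    qed
    ultimately have "a k \<in> ?L" using S.genideal_minimal k by blast
    then obtain g where g: "g \<in> J" "degree g \<le> d k" "coeff g (d k) = a k" by blast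
    have "- g \<in> J"
      using Ji(4)[of "- 1" g] g(1) P' by simp
    then have gI: "f k - g \<in> I" using I' f(1)[of k] JI by (metis add_uminus_conv_diff subsetD)
    have nJ: "f k - g \<notin> J"
      using Ji(3)[of "f k - g" g] g(1) f(2)[of k] by (auto simp: J_def)
    have le: "degree (f k - g) \<le> d k"
      using g(2) by (intro degree_diff_le) (auto simp: d_def)
    have "degree (f k - g) < d k"
    proof (cases "d k = 0")
      case True
      then have "coeff (f k - g) i = 0" for i
        using le g(3) coeff_eq_0[of "f k - g" i] by (cases "i = 0") (simp_all add: a_def)
      then have "f k - g = 0" by (intro poly_eqI) simp
      then show ?thesis using nJ Ji(2) by simp
    next
      case False
      have "coeff (f k - g) (d k) = 0" using g(3) by (simp add: a_def)
      with False le show ?thesis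
        by (metis eq_zero_or_degree_less degree_0 not_gr_zero)
    qed
    moreover have "d k \<le> degree (f k - g)"
      unfolding d_def using f(3)[OF gI] nJ by (simp add: J_def)
    ultimately show False by simp
  qed
qed

lemma noetherian_image:
  fixes h :: "'a::comm_ring_1 \<Rightarrow> 'b::comm_ring_1"
  assumes "comm_ring_hom h" and S: "closed_subring S" and noeth: "noetherian_ring (subset_ring S)"
  shows "closed_subring (h ` S) \<and> noetherian_ring (subset_ring (h ` S))"
proof
  interpret h: comm_ring_hom h by fact
  note S' = closed_subringD[OF S]
  show T: "closed_subring (h ` S)"
    unfolding closed_subring_def
    by (auto simp flip: h.hom_one h.hom_uminus h.hom_add h.hom_mult intro!: imageI S')
  interpret S: cring "subset_ring S" by (rule cring_subset_ring[OF S])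
  interpret T: cring "subset_ring (h ` S)" by (rule cring_subset_ring[OF T])
  have pre: "ideal {x \<in> S. h x \<in> I} (subset_ring S)" if "ideal I (subset_ring (h ` S))" for I
    using that unfolding ideal_subset_ring_iff[OF T] ideal_subset_ring_iff[OF S]
    by (auto simp: h.hom_zero h.hom_add h.hom_mult S')
  show "noetherian_ring (subset_ring (h ` S))"
  proof (rule T.noetherian_ringI)
    fix I assume I: "ideal I (subset_ring (h ` S))"
    have sub: "I \<subseteq> h ` S" using I unfolding ideal_subset_ring_iff[OF T] by blast
    obtain A where A: "A \<subseteq> S" "finite A" "{x \<in> S. h x \<in> I} = Idl\<^bsub>subset_ring S\<^esub> A"
      using noetherian_ring.finetely_gen[OF noeth pre[OF I]] by auto
    have hA: "h ` A \<subseteq> carrier (subset_ring (h ` S))" using A(1) by auto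
    have "I = Idl\<^bsub>subset_ring (h ` S)\<^esub> (h ` A)"
    proof
      have "A \<subseteq> {x \<in> S. h x \<in> I}" using A S.genideal_self by simp
      then show "Idl\<^bsub>subset_ring (h ` S)\<^esub> (h ` A) \<subseteq> I"
        by (intro T.genideal_minimal[OF I]) auto
      have "Idl\<^bsub>subset_ring S\<^esub> A \<subseteq> {x \<in> S. h x \<in> Idl\<^bsub>subset_ring (h ` S)\<^esub> (h ` A)}"
        by (rule S.genideal_minimal[OF pre[OF T.genideal_ideal[OF hA]]])
          (use A(1) T.genideal_self[OF hA] in auto)
      then show "I \<subseteq> Idl\<^bsub>subset_ring (h ` S)\<^esub> (h ` A)"
        using A(3) sub by blast
    qed
    then show "\<exists>A\<subseteq>carrier (subset_ring (h ` S)). finite A \<and> I = Idl\<^bsub>subset_ring (h ` S)\<^esub> A"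
      using hA A(2) by blast
  qed
qed

lemma noetherian_reals: "noetherian_ring (subset_ring (UNIV :: real set))"
proof -
  have U: "closed_subring (UNIV :: real set)" by (simp add: closed_subring_def)
  interpret cring "subset_ring (UNIV :: real set)" by (rule cring_subset_ring[OF U])
  show ?thesis
  proof (rule noetherian_ringI)
    fix I assume I: "ideal I (subset_ring (UNIV :: real set))"
    obtain a where a: "a \<in> I" "I \<subseteq> range (\<lambda>c. c * a)"
    proof (cases "\<exists>a\<in>I. a \<noteq> 0")
      case True
      then obtain a where a: "a \<in> I" "a \<noteq> 0" by blast
      have "I \<subseteq> range (\<lambda>c. c * a)"
      proof
        fix x
        have "x = (x / a) * a" using a(2) by simp
        then show "x \<in> range (\<lambda>c. c * a)" by (rule range_eqI)
      qed
      with a(1) that show ?thesis by blast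
    next
      case False
      then show ?thesis
        using that[of 0] I unfolding ideal_subset_ring_iff[OF U] by force
    qed
    have "I = Idl\<^bsub>subset_ring UNIV\<^esub> {a}"
    proof
      show "Idl\<^bsub>subset_ring UNIV\<^esub> {a} \<subseteq> I" by (rule genideal_minimal[OF I]) (use a in auto)
      have "ideal (Idl\<^bsub>subset_ring UNIV\<^esub> {a}) (subset_ring UNIV)" by (rule genideal_ideal) auto
      moreover have "a \<in> Idl\<^bsub>subset_ring UNIV\<^esub> {a}" using genideal_self[of "{a}"] by auto
      ultimately show "I \<subseteq> Idl\<^bsub>subset_ring UNIV\<^esub> {a}"
        using a(2) unfolding ideal_subset_ring_iff[OF U] by blast
    qed
    then show "\<exists>A\<subseteq>carrier (subset_ring UNIV). finite A \<and> I = Idl\<^bsub>subset_ring UNIV\<^esub> A" by auto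
  qed
qed

lemma mp_ring_eq_subset_ring: "mp_ring n = subset_ring {p. mp_vars p \<subseteq> {..<n}}"
  by (simp add: mp_ring_def subset_ring_def)

lemma closed_subring_mp: "closed_subring {p. mp_vars p \<subseteq> V}"
  unfolding closed_subring_def
proof (intro conjI ballI; (elim CollectE)?; intro CollectI)
  fix x y :: mpoly assume "mp_vars x \<subseteq> V" "mp_vars y \<subseteq> V"
  then show "mp_vars (x + y) \<subseteq> V" "mp_vars (x * y) \<subseteq> V"
    using mp_vars_add[of x y] mp_vars_mult[of x y] by blast+
qed simp_all



text \<open>The ring in \<open>n + 1\<close> variables is the image of the univariate polynomials over the ring in \<open>n\<close>
  variables under evaluation at the last variable.\<close>

theorem noetherian_mp_ring: "noetherian_ring (mp_ring n)"
proof (induction n)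
  case 0
  have "{p. mp_vars p \<subseteq> {..<0}} = range mp_const"
  proof safe
    fix p assume "mp_vars p \<subseteq> {..<0}"
    then show "p \<in> range mp_const"
      by (induction rule: mp_induct) (auto simp flip: mp_const.hom_add mp_const.hom_mult)
  qed auto
  moreover have "comm_ring_hom mp_const" by (rule mp_const.comm_ring_hom_axioms)
  ultimately show ?case
    using noetherian_image[of mp_const UNIV] noetherian_reals
    by (simp add: mp_ring_eq_subset_ring closed_subring_def)
next
  case (Suc n)
  let ?S = "{p. mp_vars p \<subseteq> {..<n}}" and ?h = "\<lambda>p. poly p (mp_var n)"
  let ?P = "{p. \<forall>i. coeff p i \<in> ?S}"
  have hom: "comm_ring_hom ?h" by unfold_locales auto
  have P: "closed_subring ?P" "noetherian_ring (subset_ring ?P)"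
    using hilbert_basis[OF closed_subring_mp[of "{..<n}"]] Suc by (simp_all add: mp_ring_eq_subset_ring)
  have "{p. mp_vars p \<subseteq> {..<Suc n}} = ?h ` ?P"
  proof (intro equalityI subsetI)
    fix p assume "p \<in> {p. mp_vars p \<subseteq> {..<Suc n}}"
    then have "mp_vars p \<subseteq> {..<Suc n}" by simp
    then show "p \<in> ?h ` ?P"
    proof (induction rule: mp_induct)
      case (const c)
      show ?case
      proof (rule image_eqI)
        show "mp_const c = poly [:mp_const c:] (mp_var n)" by simp
        show "[:mp_const c:] \<in> ?P" by (simp add: coeff_pCons split: nat.split)
      qed
    next
      case (var i)
      consider "i = n" | "i < n" using var by (cases "i = n") auto
      then show ?case
      proof cases
        case 1
        show ?thesis
        proof (rule image_eqI)
          show "mp_var i = poly [:0, 1:] (mp_var n)" by (simp add: 1)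
          show "[:0, 1:] \<in> ?P" by (simp add: coeff_pCons split: nat.split)
        qed
      next
        case 2
        show ?thesis
        proof (rule image_eqI)
          show "mp_var i = poly [:mp_var i:] (mp_var n)" by simp
          show "[:mp_var i:] \<in> ?P" using 2 by (simp add: coeff_pCons split: nat.split)
        qed
      qed
    next
      case (add p q)
      from add(3) obtain a where a: "p = ?h a" "a \<in> ?P" by (rule imageE)
      from add(4) obtain b where b: "q = ?h b" "b \<in> ?P" by (rule imageE)
      from a b show ?case
        using closed_subringD(4)[OF P(1)] by (intro image_eqI[of _ _ "a + b"]) simp_all
    next
      case (mult p q)
      from mult(3) obtain a where a: "p = ?h a" "a \<in> ?P" by (rule imageE)
      from mult(4) obtain b where b: "q = ?h b" "b \<in> ?P" by (rule imageE)
      from a b show ?case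
        using closed_subringD(6)[OF P(1)] by (intro image_eqI[of _ _ "a * b"]) simp_all
    qed
  next
    fix q assume "q \<in> ?h ` ?P"
    then obtain p where q: "q = poly p (mp_var n)" and "p \<in> ?P" by (rule imageE)
    then have p: "\<forall>i. coeff p i \<in> ?S" by simp
    show "q \<in> {p. mp_vars p \<subseteq> {..<Suc n}}"
      unfolding q
      unfolding poly_altdef
      by (intro closed_subring_sum closed_subring_mp closed_subringD(6)[OF closed_subring_mp]
            closed_subring_power[OF closed_subring_mp])
        (use p in force)+
  qed
  then show ?case
    using noetherian_image[OF hom P] by (simp add: mp_ring_eq_subset_ring)
qed

section \<open>Isolated primary components in Noetherian rings\<close>

locale noetherian_cring = noetherian_ring + cring

context noetherian_cring
begin

lemma add_minus_cancel_left:
  assumes "u \<in> carrier R" "v \<in> carrier R" shows "(u \<oplus> v) \<ominus> u = v"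
  using assms by (simp add: a_minus_def a_comm[of u v] a_assoc r_neg)

text \<open>Induction from larger ideals to smaller ones; it is well-founded because every chain of ideals
  contains its union.\<close>

lemma noetherian_induct [consumes 1, case_names step]:
  assumes "ideal I R"
    and step: "\<And>I. ideal I R \<Longrightarrow> (\<And>J. ideal J R \<Longrightarrow> I \<subset> J \<Longrightarrow> P J) \<Longrightarrow> P I"
  shows "P I"
proof (rule ccontr)
  assume "\<not> P I"
  let ?S = "{I. ideal I R \<and> \<not> P I}"
  have "\<exists>M\<in>?S. \<forall>X\<in>?S. M \<subseteq> X \<longrightarrow> X = M"
  proof (rule subset_Zorn)
    fix C assume C: "subset.chain ?S C"
    show "\<exists>U\<in>?S. \<forall>X\<in>C. X \<subseteq> U"
    proof (cases "C = {}")
      case True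
      with \<open>\<not> P I\<close> assms(1) show ?thesis by auto
    next
      case False
      have "subset.chain {I. ideal I R} C"
        using C unfolding pred_on.chain_def by blast
      then have "\<Union>C \<in> C" using False by (intro ideal_chain_is_trivial)
      moreover from this have "\<Union>C \<in> ?S" using C unfolding pred_on.chain_def by blast
      ultimately show ?thesis by blast
    qed
  qed
  then obtain M where M: "ideal M R" "\<not> P M" "\<And>X. ideal X R \<Longrightarrow> \<not> P X \<Longrightarrow> M \<subseteq> X \<Longrightarrow> X = M"
    by blast
  have "P M"
    by (rule step[OF M(1)]) (use M(3) in blast)
  with M(2) show False ..
qed

abbreviation adjoin :: "'a set \<Rightarrow> 'a \<Rightarrow> 'a set" where
  "adjoin I a \<equiv> set_add R I (PIdl a)"

lemma ideal_sum_generated: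
  assumes "ideal I R" "a \<in> carrier R"
  shows "ideal (adjoin I a) R" "I \<subseteq> adjoin I a" "a \<in> adjoin I a"
    "x \<in> adjoin I a \<longleftrightarrow> (\<exists>i\<in>I. \<exists>r\<in>carrier R. x = i \<oplus> r \<otimes> a)"
proof -
  interpret I: ideal I R by fact
  show mem: "x \<in> adjoin I a \<longleftrightarrow> (\<exists>i\<in>I. \<exists>r\<in>carrier R. x = i \<oplus> r \<otimes> a)" for x
    unfolding set_add_def' cgenideal_def by blast
  show "ideal (adjoin I a) R"
    by (intro add_ideals assms cgenideal_ideal)
  show "I \<subseteq> adjoin I a"
  proof
    fix x assume "x \<in> I"
    then show "x \<in> adjoin I a"
      unfolding mem using assms(2) I.Icarr by (intro bexI[of _ x] bexI[of _ \<zero>]) auto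
  qed
  show "a \<in> adjoin I a"
    unfolding mem using assms(2) I.zero_closed by (intro bexI[of _ \<zero>] bexI[of _ \<one>]) auto
qed

definition irreducible_ideal :: "'a set \<Rightarrow> bool" where
  "irreducible_ideal I \<longleftrightarrow> ideal I R \<and> I \<noteq> carrier R \<and>
     (\<forall>A B. ideal A R \<longrightarrow> ideal B R \<longrightarrow> I = A \<inter> B \<longrightarrow> I = A \<or> I = B)"

text \<open>Let \<open>a b \<in> I\<close>. The ideals \<open>(I : b\<^sup>k)\<close> stabilize at some \<open>k\<close>, and then
  \<open>I = (I + (a)) \<inter> (I + (b\<^sup>k))\<close>, so that one of the two ideals on the right is \<open>I\<close>.\<close>

lemma irreducible_imp_primary:
  assumes "irreducible_ideal I"
  shows "primary_ideal I R"
  unfolding primary_ideal_def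
proof (intro conjI ballI impI)
  show I: "ideal I R" "I \<noteq> carrier R"
    using assms by (auto simp: irreducible_ideal_def)
  interpret I: ideal I R by (rule I)
  fix a b assume a: "a \<in> carrier R" and b: "b \<in> carrier R" and ab: "a \<otimes> b \<in> I"
  let ?A = "\<lambda>k::nat. {x \<in> carrier R. x \<otimes> b [^] k \<in> I}"
  have A_ideal: "ideal (?A k) R" for k
  proof (rule idealI)
    show "subgroup (?A k) (add_monoid R)"
    proof (rule add.subgroupI)
      show "?A k \<noteq> {}" using b I.zero_closed by (auto intro!: exI[of _ \<zero>])
      fix x y assume "x \<in> ?A k" "y \<in> ?A k"
      then show "x \<oplus> y \<in> ?A k" using b by (auto simp: l_distr)
    next
      fix x assume x: "x \<in> ?A k"
      then have "(\<ominus> x) \<otimes> b [^] k = \<ominus> (x \<otimes> b [^] k)" using b by (simp add: l_minus)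
      then show "\<ominus> x \<in> ?A k" using x by (simp add: I.a_inv_closed)
    qed auto
  next
    fix x r assume x: "x \<in> ?A k" and r: "r \<in> carrier R"
    then have "r \<otimes> x \<otimes> b [^] k = r \<otimes> (x \<otimes> b [^] k)" using b by (simp add: m_assoc)
    then show "r \<otimes> x \<in> ?A k" using x r I.I_l_closed by simp
    then show "x \<otimes> r \<in> ?A k" using x r by (simp add: m_comm)
  qed (rule ring_axioms)
  have A_Suc: "?A k \<subseteq> ?A (Suc k)" for k
  proof
    fix x assume x: "x \<in> ?A k"
    then have "x \<otimes> b [^] Suc k = (x \<otimes> b [^] k) \<otimes> b" using b by (simp add: m_assoc)
    then show "x \<in> ?A (Suc k)" using x b I.I_r_closed by simp
  qed
  have mono: "?A j \<subseteq> ?A k" if "j \<le> k" for j k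
    using lift_Suc_mono_le[of ?A, OF A_Suc that] .
  have "subset.chain {I. ideal I R} (range ?A)"
    unfolding pred_on.chain_def
  proof (intro conjI ballI)
    show "range ?A \<subseteq> {I. ideal I R}" using A_ideal by blast
    fix X Y assume "X \<in> range ?A" "Y \<in> range ?A"
    then obtain j k where "X = ?A j" "Y = ?A k" by blast
    then show "(\<subset>)\<^sup>=\<^sup>= X Y \<or> (\<subset>)\<^sup>=\<^sup>= Y X"
      using mono[of j k] mono[of k j] by (cases "j \<le> k") (auto simp del: Collect_mono_iff mem_Collect_eq)
  qed
  then have "\<Union>(range ?A) \<in> range ?A" by (intro ideal_chain_is_trivial) auto
  then obtain k where k: "\<Union>(range ?A) = ?A k" by blast
  have stable: "?A (Suc k) \<subseteq> ?A k" using k by blast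
  have bk: "b [^] k \<in> carrier R" using b by simp
  have "I = (adjoin I a) \<inter> (adjoin I (b [^] k))"
  proof
    show "I \<subseteq> (adjoin I a) \<inter> (adjoin I (b [^] k))"
      using ideal_sum_generated(2)[OF I(1) a] ideal_sum_generated(2)[OF I(1) bk] by blast
    show "(adjoin I a) \<inter> (adjoin I (b [^] k)) \<subseteq> I"
    proof
      fix x assume "x \<in> (adjoin I a) \<inter> (adjoin I (b [^] k))"
      then obtain i r j s where i: "i \<in> I" "r \<in> carrier R" "x = i \<oplus> r \<otimes> a"
        and j: "j \<in> I" "s \<in> carrier R" "x = j \<oplus> s \<otimes> b [^] k"
        using ideal_sum_generated(4)[OF I(1) a] ideal_sum_generated(4)[OF I(1) bk] by blast
      note c = I.Icarr[OF i(1)] I.Icarr[OF j(1)] i(2) j(2) a b bk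
      have "x \<otimes> b = i \<otimes> b \<oplus> r \<otimes> (a \<otimes> b)"
        unfolding i(3) using c by (simp add: l_distr m_assoc)
      then have xb: "x \<otimes> b \<in> I"
        using c i(1) ab I.I_r_closed I.I_l_closed I.a_closed by simp
      have "s \<otimes> b [^] Suc k = x \<otimes> b \<ominus> j \<otimes> b"
        unfolding j(3) using c add_minus_cancel_left[of "j \<otimes> b" "s \<otimes> (b [^] k \<otimes> b)"]
        by (simp add: l_distr m_assoc)
      then have "s \<otimes> b [^] Suc k \<in> I"
        using xb j(1) c I.I_r_closed I.a_closed I.a_inv_closed by (simp add: a_minus_def)
      then have "s \<otimes> b [^] k \<in> I" using stable c by auto
      then show "x \<in> I" unfolding j(3) using j(1) I.a_closed by simp
    qed
  qed
  then have "I = adjoin I a \<or> I = adjoin I (b [^] k)"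
    using assms ideal_sum_generated(1)[OF I(1) a] ideal_sum_generated(1)[OF I(1) bk]
    unfolding irreducible_ideal_def by blast
  then show "a \<in> I \<or> (\<exists>k::nat. b [^] k \<in> I)"
    using ideal_sum_generated(3)[OF I(1) a] ideal_sum_generated(3)[OF I(1) bk] by blast
qed

theorem exists_primary_decomposition:
  assumes "ideal I R"
  shows "\<exists>D. finite D \<and> (\<forall>Q\<in>D. primary_ideal Q R) \<and> I = carrier R \<inter> \<Inter>D"
  using assms
proof (induction rule: noetherian_induct)
  case (step I)
  have sub: "I \<subseteq> carrier R" using ideal.Icarr[OF step(1)] by blast
  consider "I = carrier R" | "irreducible_ideal I"
    | A B where "ideal A R" "ideal B R" "I = A \<inter> B" "I \<noteq> A" "I \<noteq> B"
    using step(1) unfolding irreducible_ideal_def by metis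
  then show ?case
  proof cases
    case 1
    then show ?thesis by (intro exI[of _ "{}"]) auto
  next
    case 2
    then show ?thesis using irreducible_imp_primary sub by (intro exI[of _ "{I}"]) auto
  next
    case 3
    then have "I \<subset> A" "I \<subset> B" by auto
    with step(2) 3 obtain DA DB where
      "finite DA" "\<forall>Q\<in>DA. primary_ideal Q R" "A = carrier R \<inter> \<Inter>DA"
      "finite DB" "\<forall>Q\<in>DB. primary_ideal Q R" "B = carrier R \<inter> \<Inter>DB"
      by metis
    then show ?thesis using 3(3) by (intro exI[of _ "DA \<union> DB"]) auto
  qed
qed

lemma ideal_radical_Int:
  assumes "ideal A R" "ideal B R"
  shows "ideal_radical R (A \<inter> B) = ideal_radical R A \<inter> ideal_radical R B"
proof
  show "ideal_radical R A \<inter> ideal_radical R B \<subseteq> ideal_radical R (A \<inter> B)"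
  proof
    fix a assume "a \<in> ideal_radical R A \<inter> ideal_radical R B"
    then obtain k l :: nat where a: "a \<in> carrier R" "a [^] k \<in> A" "a [^] l \<in> B"
      unfolding ideal_radical_def by blast
    have "a [^] k \<otimes> a [^] l \<in> A" "a [^] k \<otimes> a [^] l \<in> B"
      using a ideal.I_r_closed[OF assms(1)] ideal.I_l_closed[OF assms(2)] by simp_all
    then show "a \<in> ideal_radical R (A \<inter> B)"
      using a(1) unfolding ideal_radical_def by (auto simp: nat_pow_mult)
  qed
qed (auto simp: ideal_radical_def)

lemma primary_ideal_Int:
  assumes A: "primary_ideal A R" and B: "primary_ideal B R"
    and rad: "ideal_radical R A = ideal_radical R B"
  shows "primary_ideal (A \<inter> B) R"
  unfolding primary_ideal_def
proof (intro conjI ballI impI)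
  have id: "ideal A R" "ideal B R" using A B by (auto simp: primary_ideal_def)
  show "ideal (A \<inter> B) R" by (rule i_intersect[OF id])
  show "A \<inter> B \<noteq> carrier R"
    using A ideal.Icarr[OF id(1)] unfolding primary_ideal_def by blast
  fix a b assume ab: "a \<in> carrier R" "b \<in> carrier R" "a \<otimes> b \<in> A \<inter> B"
  show "a \<in> A \<inter> B \<or> (\<exists>k::nat. b [^] k \<in> A \<inter> B)"
  proof (cases "a \<in> A \<inter> B")
    case False
    then have "b \<in> ideal_radical R A \<or> b \<in> ideal_radical R B"
      using A B ab unfolding primary_ideal_def ideal_radical_def by blast
    then have "b \<in> ideal_radical R (A \<inter> B)"
      by (simp add: ideal_radical_Int[OF id] rad)
    then show ?thesis by (simp add: ideal_radical_def)
  qed simp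
qed

lemma subset_ideal_radical:
  assumes "ideal Q R" shows "Q \<subseteq> ideal_radical R Q"
proof
  fix x assume "x \<in> Q"
  then show "x \<in> ideal_radical R Q"
    using ideal.Icarr[OF assms] by (auto simp: ideal_radical_def intro!: exI[of _ "1::nat"])
qed

text \<open>Outside the zeros of \<open>s\<close> the ideals \<open>I\<close> and \<open>Q\<close> agree. Because \<open>s\<close> is not nilpotent modulo
  the primary ideal \<open>Q\<close>, this gives \<open>I = Q \<inter> (I + (s))\<close>. Among all finite families of primary ideals
  containing \<open>s\<close> that represent \<open>I\<close> together with \<open>Q\<close>, one of minimal size is irredundant
  and has pairwise different radicals, since two primary ideals with the same radical could be
  replaced by their intersection. No radical in the family lies inside that of \<open>Q\<close>, because it
  contains \<open>s\<close>.\<close>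

theorem isolated_primary_componentI:
  assumes I: "ideal I R" and Q: "primary_ideal Q R" and IQ: "I \<subseteq> Q"
    and s: "s \<in> carrier R" "s \<notin> ideal_radical R Q"
    and sQ: "\<And>q. q \<in> Q \<Longrightarrow> s \<otimes> q \<in> I"
  shows "isolated_primary_component R I (ideal_radical R Q) Q"
proof -
  interpret I: ideal I R by (rule I)
  have Qi: "ideal Q R" using Q by (simp add: primary_ideal_def)
  interpret Q: ideal Q R by (rule Qi)
  have sQ': "s \<notin> Q" using s(2) subset_ideal_radical[OF Qi] by blast
  let ?J = "adjoin I s"
  note J = ideal_sum_generated[OF I s(1)]
  have I_eq: "I = Q \<inter> ?J"
  proof
    show "I \<subseteq> Q \<inter> ?J" using IQ J(2) by blast
    show "Q \<inter> ?J \<subseteq> I"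
    proof
      fix x assume x: "x \<in> Q \<inter> ?J"
      then obtain i r where ir: "i \<in> I" "r \<in> carrier R" "x = i \<oplus> r \<otimes> s" using J(4) by blast
      have "r \<otimes> s = x \<ominus> i"
        unfolding ir(3) using ir(2) s(1) I.Icarr[OF ir(1)] by (simp add: add_minus_cancel_left)
      then have "r \<otimes> s \<in> Q"
        using x ir(1) IQ Q.a_closed Q.a_inv_closed by (simp add: a_minus_def subset_iff)
      then have "r \<in> Q"
        using Q ir(2) s unfolding primary_ideal_def ideal_radical_def by blast
      from sQ[OF this] have "r \<otimes> s \<in> I" using ir(2) s(1) by (simp add: m_comm)
      then show "x \<in> I" using ir I.a_closed by simp
    qed
  qed
  \<comment> \<open>finite families of primary ideals that contain \<open>s\<close> and, together with \<open>Q\<close>, intersect in \<open>I\<close>\<close>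
  define good where "good D \<longleftrightarrow> finite D \<and> (\<forall>X\<in>D. primary_ideal X R \<and> s \<in> X) \<and> I = Q \<inter> \<Inter>D" for D
  have "\<exists>D. good D"
  proof -
    obtain D where D: "finite D" "\<forall>X\<in>D. primary_ideal X R" "?J = carrier R \<inter> \<Inter>D"
      using exists_primary_decomposition[OF J(1)] by blast
    have "I = Q \<inter> \<Inter>D" using I_eq D(3) Q.Icarr by blast
    moreover have "\<forall>X\<in>D. s \<in> X" using J(3) D(3) by blast
    ultimately have "good D" using D(1,2) by (simp add: good_def)
    then show ?thesis ..
  qed
  then obtain D where D: "good D" and min: "\<And>D'. good D' \<Longrightarrow> card D \<le> card D'"
    using ex_has_least_nat[of good _ card] by blast
  have Dfin: "finite D" and Dp: "\<And>X. X \<in> D \<Longrightarrow> primary_ideal X R" and Ds: "\<And>X. X \<in> D \<Longrightarrow> s \<in> X"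
    and DI: "I = Q \<inter> \<Inter>D" using D by (auto simp: good_def)
  have rad_s: "s \<in> ideal_radical R X" if "X \<in> D" for X
    using subset_ideal_radical Dp[OF that] Ds[OF that] unfolding primary_ideal_def by blast
  have QD: "Q \<notin> D" using Ds sQ' by blast
  have irred: "\<not> good D'" if "card D' < card D" for D'
    using min[of D'] that by auto
  have "primary_decomposition R I (insert Q D)"
    unfolding primary_decomposition_def
  proof (intro conjI ballI)
    show "finite (insert Q D)" using Dfin by simp
    show "primary_ideal X R" if "X \<in> insert Q D" for X using that Q Dp by blast
    show "I = carrier R \<inter> \<Inter>(insert Q D)" using DI Q.Icarr by blast
    show "inj_on (ideal_radical R) (insert Q D)"
    proof (subst inj_on_insert, intro conjI)
      show "ideal_radical R Q \<notin> ideal_radical R ` (D - {Q})" using rad_s s(2) by blast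
      show "inj_on (ideal_radical R) D"
      proof (rule inj_onI, rule ccontr)
        fix X Y assume XY: "X \<in> D" "Y \<in> D" "ideal_radical R X = ideal_radical R Y" "X \<noteq> Y"
        let ?D' = "insert (X \<inter> Y) (D - {X, Y})"
        have "card ?D' \<le> Suc (card (D - {X, Y}))" by (rule card_insert_le_m1) simp_all
        also have "card (D - {X, Y}) = card D - 2"
          using XY Dfin by (subst card_Diff_subset) auto
        also have "Suc (card D - 2) < card D"
        proof -
          have "card {X, Y} \<le> card D" using XY Dfin by (intro card_mono) auto
          then show ?thesis using XY(4) by simp
        qed
        finally have "\<not> good ?D'" by (rule irred)
        moreover have "good ?D'"
          unfolding good_def
        proof (intro conjI ballI)
          show "finite ?D'" using Dfin by simp
          show "I = Q \<inter> \<Inter>?D'" using DI XY(1,2) by blast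
          fix Z assume "Z \<in> ?D'"
          then consider "Z = X \<inter> Y" | "Z \<in> D" by blast
          then have "primary_ideal Z R \<and> s \<in> Z"
          proof cases
            case 1
            then show ?thesis
              using Ds XY(1,2) primary_ideal_Int[OF Dp[OF XY(1)] Dp[OF XY(2)] XY(3)] by simp
          qed (simp add: Dp Ds)
          then show "primary_ideal Z R" "s \<in> Z" by simp_all
        qed
        ultimately show False by blast
      qed
    qed
    show "\<not> carrier R \<inter> \<Inter>(insert Q D - {X}) \<subseteq> X" if "X \<in> insert Q D" for X
    proof (cases "X = Q")
      case True
      have "insert Q D - {Q} = D" using QD by auto
      moreover have "s \<in> carrier R \<inter> \<Inter>D" using Ds s(1) by blast
      ultimately show ?thesis using True sQ' by blast
    next
      case False
      then have X: "X \<in> D" using that by blast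
      show ?thesis
      proof
        assume sub: "carrier R \<inter> \<Inter>(insert Q D - {X}) \<subseteq> X"
        have "I = Q \<inter> \<Inter>(D - {X})"
        proof
          show "I \<subseteq> Q \<inter> \<Inter>(D - {X})" using DI by blast
          show "Q \<inter> \<Inter>(D - {X}) \<subseteq> I"
          proof
            fix x assume x: "x \<in> Q \<inter> \<Inter>(D - {X})"
            then have "x \<in> X" using sub Q.Icarr by blast
            with x DI show "x \<in> I" by blast
          qed
        qed
        then have "good (D - {X})" using Dfin Dp Ds unfolding good_def by blast
        moreover have "card (D - {X}) < card D" using Dfin X by (rule card_Diff1_less)
        ultimately show False using irred by blast
      qed
    qed
  qed
  moreover have "ideal_radical R X = ideal_radical R Q"
    if "X \<in> insert Q D" "ideal_radical R X \<subseteq> ideal_radical R Q" for X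
    using that rad_s s(2) by blast
  ultimately show ?thesis
    unfolding isolated_primary_component_def by blast
qed

end

section \<open>The deflated system and truncated arcs\<close>

text \<open>The coordinates of the generic arc \<open>x + a\<^sub>2 t + \<dots> + a\<^sub>K t\<^sup>K\<^sup>-\<^sup>1\<close>, with \<open>x\<close> and \<open>a\<close> still
  polynomials. Variables from \<open>n\<close> on are constant along the arc.\<close>

definition jet :: "nat \<Rightarrow> nat \<Rightarrow> (nat \<Rightarrow> nat \<Rightarrow> mpoly) \<Rightarrow> nat \<Rightarrow> mpoly poly" where
  "jet n K a l = [:mp_var l:] + (if l < n then \<Sum>k=2..K. monom (a k l) (k - 1) else 0)"

abbreviation jet_subst :: "nat \<Rightarrow> nat \<Rightarrow> (nat \<Rightarrow> nat \<Rightarrow> mpoly) \<Rightarrow> mpoly \<Rightarrow> mpoly poly" where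
  "jet_subst n K a \<equiv> mp_subst (\<lambda>c. [:mp_const c:]) (jet n K a)"

lemma comm_ring_hom_const_poly:
  assumes "comm_ring_hom h" shows "comm_ring_hom (\<lambda>c. [:h c:])"
proof -
  interpret comm_ring_hom h by fact
  show ?thesis by unfold_locales (auto simp: hom_add hom_mult hom_one hom_zero)
qed

lemma mp_substitution_jet: "mp_substitution (\<lambda>c. [:mp_const c:])"
  by (intro mp_substitution.intro comm_ring_hom_const_poly mp_const.comm_ring_hom_axioms)

lemma coeff_jet:
  assumes "l < n" "1 \<le> j" "j < K"
  shows "coeff (jet n K a l) j = a (Suc j) l"
proof -
  have "(\<Sum>k=2..K. coeff (monom (a k l) (k - 1)) j) = (\<Sum>k=2..K. if k = Suc j then a k l else 0)"
    using assms by (intro sum.cong) auto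
  also have "\<dots> = a (Suc j) l" using assms by simp
  finally show ?thesis
    using assms by (simp add: jet_def coeff_sum coeff_pCons split: nat.splits)
qed

lemma coeff_jet_0: "coeff (jet n K a l) 0 = mp_var l"
proof -
  have "(\<Sum>k=2..K. coeff (monom (a k l) (k - 1)) 0) = 0" by (intro sum.neutral) auto
  then show ?thesis by (simp add: jet_def coeff_sum)
qed

lemma coeff_0_jet_subst: "coeff (jet_subst n K a p) 0 = p"
proof -
  interpret J: mp_substitution "\<lambda>c. [:mp_const c:]" "jet n K a" by (rule mp_substitution_jet)
  have "comm_ring_hom (\<lambda>p. coeff (jet_subst n K a p) 0)"
    by unfold_locales
      (auto simp: J.hom_add J.hom_mult J.hom_one J.hom_zero coeff_mult_0)
  from mp_hom_eqI[OF this comm_ring_hom_id, of p "mp_vars p"] show ?thesis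
    by (simp add: J.subst_const J.subst_var coeff_jet_0)
qed

text \<open>A derivation acts coefficientwise on polynomials in a new variable, again as a derivation.\<close>

lemma map_poly_derivation:
  assumes add: "\<And>p q. d (p + q) = d p + d q"
    and mult: "\<And>p q. d (p * q) = h p * d q + d p * h q"
    and h: "comm_ring_hom h"
  shows "map_poly d (p + q) = map_poly d p + map_poly d q"
    "map_poly d (p * q) = map_poly h p * map_poly d q + map_poly d p * map_poly h q"
proof -
  interpret comm_ring_hom h by fact
  have d0: "d 0 = 0" using add[of 0 0] by simp
  have dsum: "d (sum f A) = (\<Sum>x\<in>A. d (f x))" for f and A :: "'c set"
    by (induction A rule: infinite_finite_induct) (auto simp: d0 add)
  show "map_poly d (p + q) = map_poly d p + map_poly d q"
    by (intro poly_eqI) (simp add: coeff_map_poly d0 add)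
  show "map_poly d (p * q) = map_poly h p * map_poly d q + map_poly d p * map_poly h q"
    by (intro poly_eqI) (simp add: coeff_map_poly d0 hom_zero coeff_mult dsum mult sum.distrib)
qed

context
  fixes n K :: nat and a :: "nat \<Rightarrow> nat \<Rightarrow> mpoly"
  assumes a_const: "\<And>k j l. l < n \<Longrightarrow> mp_pderiv l (a k j) = 0"
begin

interpretation J: mp_substitution "\<lambda>c. [:mp_const c:]" "jet n K a" by (rule mp_substitution_jet)

text \<open>Translating \<open>x\<close> translates the whole arc, so that differentiation by \<open>x\<^sub>l\<close> commutes with
  restriction to the arc.\<close>

lemma pderiv_coeff_jet_subst:
  assumes "l < n"
  shows "coeff (jet_subst n K a (mp_pderiv l p)) m = mp_pderiv l (coeff (jet_subst n K a p) m)"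
proof -
  let ?E = "jet_subst n K a"
  define D where "D q = map_poly (mp_pderiv l) (?E q)" for q
  note der = map_poly_derivation[of "mp_pderiv l" "\<lambda>x. x", OF mp_pderiv_add mp_pderiv_mult comm_ring_hom_id]
  have D_var: "D (mp_var v) = (if v = l then 1 else 0)" for v
  proof (rule poly_eqI)
    fix j
    have "mp_pderiv l (coeff (jet n K a v) j) = (if v = l \<and> j = 0 then 1 else 0)"
    proof (cases "j = 0")
      case True then show ?thesis by (simp add: coeff_jet_0 mp_pderiv_var)
    next
      case False
      then show ?thesis
        using assms by (auto simp: jet_def coeff_sum mp_pderiv_sum a_const coeff_pCons
            intro!: sum.neutral split: nat.splits)
    qed
    then show "coeff (D (mp_var v)) j = coeff (if v = l then 1 else 0) j"
      by (simp add: D_def coeff_map_poly J.subst_var)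
  qed
  have "D p = (\<Sum>v\<in>insert l (mp_vars p). ?E (mp_pderiv v p) * D (mp_var v))"
    by (rule derivation_chain_rule[OF J.comm_ring_hom_axioms])
      (auto simp: D_def J.hom_add J.hom_mult der J.subst_const map_poly_pCons mp_vars_def)
  also have "\<dots> = (\<Sum>v\<in>insert l (mp_vars p). if v = l then ?E (mp_pderiv v p) else 0)"
    by (intro sum.cong) (auto simp: D_var)
  also have "\<dots> = ?E (mp_pderiv l p)"
    by (subst sum.delta) (auto simp: mp_vars_def)
  finally have "coeff (D p) m = coeff (?E (mp_pderiv l p)) m" by simp
  then show ?thesis by (simp add: D_def coeff_map_poly)
qed

lemma pderiv_jet_subst:
  "pderiv (jet_subst n K a p) = (\<Sum>l<n. jet_subst n K a (mp_pderiv l p) * pderiv (jet n K a l))"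
proof -
  let ?E = "jet_subst n K a" and ?V = "{..<n} \<union> mp_vars p"
  have fin: "finite ?V" by (auto simp: mp_vars_def)
  have "pderiv (?E p) = (\<Sum>l\<in>?V. ?E (mp_pderiv l p) * pderiv (?E (mp_var l)))"
    by (rule derivation_chain_rule[OF J.comm_ring_hom_axioms])
      (use fin in \<open>auto simp: J.hom_add J.hom_mult pderiv_add pderiv_mult J.subst_const
        pderiv_pCons algebra_simps\<close>)
  also have "\<dots> = (\<Sum>l<n. ?E (mp_pderiv l p) * pderiv (?E (mp_var l)))"
    using fin by (intro sum.mono_neutral_right)
      (auto simp: J.subst_var jet_def pderiv_pCons)
  finally show ?thesis by (simp add: J.subst_var)
qed

text \<open>Comparing coefficients in \<open>d/dt H(\<gamma>(t)) = \<Sum>\<^sub>l (\<partial>\<^sub>l H)(\<gamma>(t)) \<gamma>\<^sub>l'(t)\<close> gives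
  \<open>m c\<^sub>m = \<Sum>\<^sub>j j (\<Sum>\<^sub>l \<partial>\<^sub>l c\<^sub>m\<^sub>-\<^sub>j a\<^sub>j\<^sub>+\<^sub>1\<^sub>,\<^sub>l)\<close> for the coefficients \<open>c\<^sub>m\<close> of \<open>H(\<gamma>(t))\<close>. Divided by
  \<open>m\<close>, this is the recursion that defines \<open>L\<^sub>m\<^sub>+\<^sub>1\<close>; its term \<open>j = m\<close> is \<open>J\<^sub>H a\<^sub>m\<^sub>+\<^sub>1\<close>.\<close>

theorem L_op_eq_coeff:
  assumes "m < K"
  shows "L_op n a H (Suc m) i = coeff (jet_subst n K a (H i)) m"
  using assms
proof (induction m rule: less_induct)
  case (less m)
  let ?E = "jet_subst n K a" and ?c = "\<lambda>j. coeff (jet_subst n K a (H i)) j"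
  show ?case
  proof (cases "m = 0")
    case True
    then show ?thesis by (subst L_op.simps) (simp add: coeff_0_jet_subst)
  next
    case False
    let ?T = "\<lambda>j. \<Sum>l<n. mp_pderiv l (?c (m - j)) * a (Suc j) l"
    have "of_nat m * ?c m = coeff (pderiv (?E (H i))) (m - 1)"
      using False by (cases m) (simp_all add: coeff_pderiv)
    also have "\<dots> = (\<Sum>l<n. \<Sum>j\<le>m - 1. mp_pderiv l (?c j) * coeff (pderiv (jet n K a l)) (m - 1 - j))"
      unfolding pderiv_jet_subst coeff_sum coeff_mult
      by (intro sum.cong refl) (simp add: pderiv_coeff_jet_subst)
    also have "\<dots> = (\<Sum>l<n. \<Sum>j\<in>{1..m}. mp_pderiv l (?c (m - j)) * coeff (pderiv (jet n K a l)) (j - 1))"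
      using False
      by (intro sum.cong refl sum.reindex_bij_witness[of _ "\<lambda>j. m - j" "\<lambda>j. m - j"]) auto
    also have "\<dots> = (\<Sum>l<n. \<Sum>j\<in>{1..m}. of_nat j * (mp_pderiv l (?c (m - j)) * a (Suc j) l))"
    proof (intro sum.cong refl)
      fix l j assume "l \<in> {..<n}" "j \<in> {1..m}"
      then have "coeff (pderiv (jet n K a l)) (j - 1) = of_nat j * a (Suc j) l"
        using less(2) coeff_jet[of l n j K a] by (cases j) (auto simp: coeff_pderiv)
      then show "mp_pderiv l (?c (m - j)) * coeff (pderiv (jet n K a l)) (j - 1) =
          of_nat j * (mp_pderiv l (?c (m - j)) * a (Suc j) l)" by simp
    qed
    also have "\<dots> = (\<Sum>j\<in>{1..m}. of_nat j * ?T j)"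
      by (subst sum.swap) (simp add: sum_distrib_left)
    finally have *: "of_nat m * ?c m = (\<Sum>j\<in>{1..m}. of_nat j * ?T j)" .
    have inv: "mp_const (1 / real m) * of_nat m = 1"
      using False by (simp flip: mp_const.hom_of_nat mp_const.hom_mult mp_const.hom_one)
    have "?c m = mp_const (1 / real m) * (of_nat m * ?c m)"
      by (simp add: inv flip: mult.assoc)
    also have "\<dots> = (\<Sum>j\<in>{1..m}. mp_const (real j / real m) * ?T j)"
      unfolding * sum_distrib_left
      by (intro sum.cong refl) (simp flip: mp_const.hom_of_nat mp_const.hom_mult mult.assoc)
    also have "{1..m} = insert m {1..Suc m - 2}" using False by auto
    also have "(\<Sum>j\<in>\<dots>. mp_const (real j / real m) * ?T j) =
        (\<Sum>j=1..Suc m - 2. mp_const (real j / real m) * ?T j) + mp_const (real m / real m) * ?T m"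
      using False by (subst sum.insert) auto
    also have "\<dots> = (\<Sum>j=1..Suc m - 2. mp_const (real j / real (Suc m - 1)) *
          jac_mult n (L_op n a H (Suc m - j)) (a (j + 1)) i) + jac_mult n H (a (Suc m)) i"
    proof (intro arg_cong2[where f = "(+)"] sum.cong refl)
      fix j assume j: "j \<in> {1..Suc m - 2}"
      then have "L_op n a H (Suc (m - j)) i = ?c (m - j)" using less False by auto
      moreover have "Suc m - j = Suc (m - j)" using j by auto
      ultimately show "mp_const (real j / real m) * ?T j = mp_const (real j / real (Suc m - 1)) *
          jac_mult n (L_op n a H (Suc m - j)) (a (j + 1)) i"
        by (simp add: jac_mult_def)
    next
      show "mp_const (real m / real m) * ?T m = jac_mult n H (a (Suc m)) i"
        using False by (simp add: jac_mult_def coeff_0_jet_subst mp_const.hom_one)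
    qed
    finally show ?thesis
      using False by (subst L_op.simps) auto
  qed
qed

end

lemma comm_ring_hom_map_poly:
  assumes "comm_ring_hom h" shows "comm_ring_hom (map_poly h)"
proof -
  interpret comm_ring_hom h by fact
  show ?thesis
  proof
    show "map_poly h (p * q) = map_poly h p * map_poly h q" for p q
      by (intro poly_eqI) (simp add: coeff_map_poly hom_zero coeff_mult hom_sum hom_mult)
  qed (auto intro!: poly_eqI simp: coeff_map_poly hom_zero hom_add hom_one)
qed

abbreviation restrict_to_arc :: "(nat \<Rightarrow> real poly) \<Rightarrow> mpoly \<Rightarrow> real poly" where
  "restrict_to_arc \<equiv> mp_subst (\<lambda>c. [:c:])"

lemma mp_substitution_arc: "mp_substitution (\<lambda>c::real. [:c:])"
  by (intro mp_substitution.intro comm_ring_hom_const_poly comm_ring_hom_id)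

lemma coeff_0_restrict_to_arc:
  assumes "\<And>l. l \<in> mp_vars p \<Longrightarrow> coeff (\<gamma> l) 0 = x l"
  shows "coeff (restrict_to_arc \<gamma> p) 0 = mp_eval p x"
proof -
  interpret S: mp_substitution "\<lambda>c::real. [:c:]" \<gamma> by (rule mp_substitution_arc)
  have "comm_ring_hom (\<lambda>p. coeff (restrict_to_arc \<gamma> p) 0)"
    by unfold_locales (auto simp: S.hom_add S.hom_mult S.hom_one S.hom_zero coeff_mult_0)
  from mp_hom_eqI[OF this mp_eval.comm_ring_hom_axioms[of x], of p "mp_vars p"] show ?thesis
    by (simp add: S.subst_const S.subst_var assms)
qed

lemma pderiv_restrict_to_arc:
  assumes "mp_vars p \<subseteq> V" "finite V"
  shows "pderiv (restrict_to_arc \<gamma> p) =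
    (\<Sum>l\<in>V. restrict_to_arc \<gamma> (mp_pderiv l p) * pderiv (\<gamma> l))"
proof -
  interpret S: mp_substitution "\<lambda>c::real. [:c:]" \<gamma> by (rule mp_substitution_arc)
  have "pderiv (restrict_to_arc \<gamma> p) =
    (\<Sum>l\<in>V. restrict_to_arc \<gamma> (mp_pderiv l p) * pderiv (restrict_to_arc \<gamma> (mp_var l)))"
    by (rule derivation_chain_rule[OF S.comm_ring_hom_axioms _ _ _ assms])
      (simp_all add: S.hom_add S.hom_mult pderiv_add pderiv_mult S.subst_const pderiv_pCons
        algebra_simps)
  then show ?thesis by (simp add: S.subst_var)
qed

text \<open>The arc whose coefficients are the values at \<open>y\<close> of the unknowns of the deflated system.\<close>

definition deflation_arc :: "nat \<Rightarrow> nat \<Rightarrow> (nat \<Rightarrow> real) \<Rightarrow> nat \<Rightarrow> real poly" where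
  "deflation_arc n \<mu> y l = map_poly (\<lambda>p. mp_eval p y) (jet n \<mu> (a_par n \<mu>) l)"

lemma mp_pderiv_a_par: "l < n \<Longrightarrow> mp_pderiv l (a_par n \<mu> k j) = 0"
  by (rule mp_pderiv_eq_0) (auto simp: a_par_def a_index_def mp_vars_def[of 0] mp_vars_def[of 1])

lemma map_poly_eval_jet_subst:
  "map_poly (\<lambda>p. mp_eval p y) (jet_subst n \<mu> (a_par n \<mu>) p) = restrict_to_arc (deflation_arc n \<mu> y) p"
proof -
  interpret J: mp_substitution "\<lambda>c. [:mp_const c:]" "jet n \<mu> (a_par n \<mu>)"
    by (rule mp_substitution_jet)
  interpret S: mp_substitution "\<lambda>c::real. [:c:]" "deflation_arc n \<mu> y"
    by (rule mp_substitution_arc)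
  interpret M: comm_ring_hom "map_poly (\<lambda>p. mp_eval p y)"
    by (intro comm_ring_hom_map_poly mp_eval.comm_ring_hom_axioms)
  have "comm_ring_hom (\<lambda>p. map_poly (\<lambda>p. mp_eval p y) (jet_subst n \<mu> (a_par n \<mu>) p))"
    by unfold_locales
      (simp_all add: J.hom_add J.hom_mult J.hom_one J.hom_zero M.hom_add M.hom_mult
        M.hom_one M.hom_zero del: map_poly_1)
  from mp_hom_eqI[OF this S.comm_ring_hom_axioms, of p "mp_vars p"] show ?thesis
    by (simp add: J.subst_const J.subst_var S.subst_const S.subst_var deflation_arc_def
        map_poly_pCons)
qed

lemma mp_eval_L_op:
  assumes "m < \<mu>"
  shows "mp_eval (L_op n (a_par n \<mu>) H (Suc m) i) y =
    coeff (restrict_to_arc (deflation_arc n \<mu> y) (H i)) m"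
  by (simp add: L_op_eq_coeff[OF mp_pderiv_a_par assms] coeff_map_poly
      flip: map_poly_eval_jet_subst)

lemma coeff_jet_beyond:
  assumes "K \<le> j" "1 \<le> j" shows "coeff (jet n K a l) j = 0"
  using assms by (auto simp: jet_def coeff_sum coeff_pCons intro!: sum.neutral split: nat.splits)

text \<open>A deformation \<open>\<Delta>\<close> of the arc as a vector in the space of the unknowns \<open>(x, b, a)\<close>: the
  coefficients of \<open>\<Delta>\<close> go to the positions of \<open>x\<close> and \<open>a\<close>, and the smoothing parameters are kept
  fixed. The quotient and the remainder by \<open>n - 1\<close> invert \<open>a_index\<close>.\<close>

definition unknown_tangent :: "nat \<Rightarrow> nat \<Rightarrow> (nat \<Rightarrow> real poly) \<Rightarrow> nat \<Rightarrow> real" where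
  "unknown_tangent n \<mu> \<Delta> v = (if v < n then coeff (\<Delta> v) 0 else if v < n + (\<mu> - 1) then 0
     else coeff (\<Delta> ((v - (n + (\<mu> - 1))) mod (n - 1) + 1)) ((v - (n + (\<mu> - 1))) div (n - 1) + 1))"

lemma unknown_tangent_a_index:
  assumes "1 \<le> l" "l < n" "2 \<le> k"
  shows "unknown_tangent n \<mu> \<Delta> (a_index n \<mu> k l) = coeff (\<Delta> l) (k - 1)"
proof -
  have r: "a_index n \<mu> k l - (n + (\<mu> - 1)) = (l - 1) + (k - 2) * (n - 1)"
    by (simp add: a_index_def)
  have "l - 1 < n - 1" using assms by auto
  then have "((l - 1) + (k - 2) * (n - 1)) mod (n - 1) = l - 1"
    "((l - 1) + (k - 2) * (n - 1)) div (n - 1) = k - 2" by auto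
  moreover have "k - 2 + 1 = k - 1" "l - 1 + 1 = l" using assms by auto
  moreover have "n + (\<mu> - 1) \<le> a_index n \<mu> k l"
    unfolding a_index_def by linarith
  ultimately show ?thesis
    unfolding unknown_tangent_def r by simp
qed

lemma a_index_less:
  assumes "1 \<le> l" "l < n" "2 \<le> k" "k \<le> \<mu>"
  shows "a_index n \<mu> k l < \<mu> * n"
proof -
  have "(k - 2) * (n - 1) + (l - 1) < (\<mu> - 2) * (n - 1) + (n - 1)"
    using assms by (intro add_le_less_mono mult_right_mono) auto
  also have "\<dots> = (\<mu> - 1) * (n - 1)"
  proof -
    have "\<mu> - 1 = Suc (\<mu> - 2)" using assms by simp
    then show ?thesis by simp
  qed
  finally have "a_index n \<mu> k l < n + (\<mu> - 1) + (\<mu> - 1) * (n - 1)"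
    unfolding a_index_def by linarith
  also have "\<dots> = \<mu> * n"
    using assms by (cases \<mu>; cases n) auto
  finally show ?thesis .
qed

text \<open>Deforming \<open>\<gamma>\<close> in direction \<open>\<Delta>\<close> changes \<open>H(\<gamma>(t))\<close> by \<open>\<Sum>\<^sub>l (\<partial>\<^sub>l H)(\<gamma>(t)) \<Delta>\<^sub>l(t)\<close> to first
  order. The first coordinate of \<open>\<Delta>\<close> is constant in \<open>t\<close>, because the first entries of the \<open>a\<^sub>k\<close>
  are not unknowns.\<close>

lemma directional_derivative_L_op:
  assumes "m < \<mu>" and vars: "mp_vars (H i) \<subseteq> {..<n + (\<mu> - 1)}"
    and deg: "\<And>l. l < n \<Longrightarrow> degree (\<Delta> l) < \<mu>" and deg0: "degree (\<Delta> 0) = 0"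
    and "2 \<le> \<mu>" "1 \<le> n"
  shows "(\<Sum>v<\<mu> * n. mp_eval (mp_pderiv v (L_op n (a_par n \<mu>) H (Suc m) i)) y * unknown_tangent n \<mu> \<Delta> v) =
    coeff (\<Sum>l<n. restrict_to_arc (deflation_arc n \<mu> y) (mp_pderiv l (H i)) * \<Delta> l) m"
proof -
  let ?E = "jet_subst n \<mu> (a_par n \<mu>)" and ?\<phi> = "restrict_to_arc (deflation_arc n \<mu> y)"
  let ?\<delta> = "unknown_tangent n \<mu> \<Delta>"
  interpret J: mp_substitution "\<lambda>c. [:mp_const c:]" "jet n \<mu> (a_par n \<mu>)"
    by (rule mp_substitution_jet)
  interpret S: mp_substitution "\<lambda>c::real. [:c:]" "deflation_arc n \<mu> y"
    by (rule mp_substitution_arc)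
  define d where "d q = (\<Sum>v<\<mu> * n. mp_eval (mp_pderiv v q) y * ?\<delta> v)" for q
  define D where "D q = map_poly d (?E q)" for q
  have d_add: "d (p + q) = d p + d q" for p q
    by (simp add: d_def mp_pderiv_add mp_eval.hom_add distrib_right sum.distrib)
  have d_mult: "d (p * q) = mp_eval p y * d q + d p * mp_eval q y" for p q
    by (simp add: d_def mp_pderiv_mult mp_eval.hom_add mp_eval.hom_mult sum.distrib
        sum_distrib_left sum_distrib_right algebra_simps)
  note der = map_poly_derivation[of d "\<lambda>p. mp_eval p y", OF d_add d_mult mp_eval.comm_ring_hom_axioms]
  have d0: "d 0 = 0" using d_add[of 0 0] by simp
  have d_const: "d (mp_const c) = 0" for c by (simp add: d_def mp_eval.hom_zero)
  have d_var: "d (mp_var v) = ?\<delta> v" if "v < \<mu> * n" for v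
  proof -
    have "d (mp_var v) = (\<Sum>u<\<mu> * n. if u = v then ?\<delta> u else 0)"
      unfolding d_def by (intro sum.cong) (auto simp: mp_pderiv_var mp_eval.hom_zero mp_eval.hom_one)
    then show ?thesis using that by simp
  qed
  have nN: "n + (\<mu> - 1) \<le> \<mu> * n"
    using assms(5,6) by (cases \<mu>; cases n) auto
  have D_var_x: "D (mp_var l) = \<Delta> l" if l: "l < n" for l
  proof (rule poly_eqI)
    fix j
    have "coeff (D (mp_var l)) j = d (coeff (jet n \<mu> (a_par n \<mu>) l) j)"
      by (simp add: D_def coeff_map_poly d0 J.subst_var)
    also have "\<dots> = coeff (\<Delta> l) j"
    proof -
      consider "j = 0" | "1 \<le> j" "j < \<mu>" | "1 \<le> j" "\<mu> \<le> j" by linarith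
      then show ?thesis
      proof cases
        case 1
        then show ?thesis using l nN by (simp add: coeff_jet_0 d_var unknown_tangent_def)
      next
        case 2
        show ?thesis
        proof (cases "l = 0")
          case True
          have "coeff (\<Delta> 0) j = 0" using 2 deg0 by (intro coeff_eq_0) simp
          moreover have "d (a_par n \<mu> (Suc j) 0) = 0"
            using d_const[of 1] d0 by (simp add: a_par_def mp_const.hom_one)
          ultimately show ?thesis using True 2 l by (simp add: coeff_jet)
        next
          case False
          then show ?thesis
            using 2 l a_index_less[of l n "Suc j" \<mu>]
            by (simp add: coeff_jet a_par_def d_var unknown_tangent_a_index)
        qed
      next
        case 3
        then show ?thesis
          using deg[OF l] by (simp add: coeff_jet_beyond d0 coeff_eq_0)
      qed
    qed
    finally show "coeff (D (mp_var l)) j = coeff (\<Delta> l) j" .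
  qed
  have D_var_b: "D (mp_var v) = 0" if "n \<le> v" "v < n + (\<mu> - 1)" for v
    using that nN
    by (simp add: D_def J.subst_var jet_def map_poly_pCons d0 d_var unknown_tangent_def)
  have M: "map_poly (\<lambda>p. mp_eval p y) (?E q) = ?\<phi> q" for q by (rule map_poly_eval_jet_subst)
  have "D (H i) = (\<Sum>l<n + (\<mu> - 1). ?\<phi> (mp_pderiv l (H i)) * D (mp_var l))"
    by (rule derivation_chain_rule[OF S.comm_ring_hom_axioms _ _ _ vars])
      (simp_all add: D_def J.hom_add J.hom_mult der M J.subst_const map_poly_pCons d0 d_const)
  also have "\<dots> = (\<Sum>l<n. ?\<phi> (mp_pderiv l (H i)) * D (mp_var l))"
    by (intro sum.mono_neutral_right) (auto simp: D_var_b)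
  also have "\<dots> = (\<Sum>l<n. ?\<phi> (mp_pderiv l (H i)) * \<Delta> l)"
    by (simp add: D_var_x)
  finally have "coeff (D (H i)) m = coeff (\<Sum>l<n. ?\<phi> (mp_pderiv l (H i)) * \<Delta> l) m" by simp
  moreover have "coeff (D (H i)) m = d (L_op n (a_par n \<mu>) H (Suc m) i)"
    by (simp add: d0 L_op_eq_coeff[OF mp_pderiv_a_par assms(1)] D_def coeff_map_poly)
  ultimately show ?thesis by (simp add: d_def)
qed

lemma mp_vars_F1:
  assumes "mp_vars (F i) \<subseteq> V" "\<And>\<nu>. \<nu> \<le> \<mu> - 2 \<Longrightarrow> mp_vars (b \<nu>) \<subseteq> V" "0 \<in> V"
  shows "mp_vars (F1 \<mu> F b i) \<subseteq> V"
proof -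
  have "mp_vars (\<Sum>\<nu>=0..\<mu> - 2. mp_const (1 / fact \<nu>) * b \<nu> * mp_var 0 ^ \<nu>) \<subseteq> V"
    by (intro mp_vars_subset_sum mp_vars_subset_mult mp_vars_subset_power)
      (use assms(2,3) in simp_all)
  then show ?thesis
    unfolding F1_def by (intro mp_vars_subset_diff[OF assms(1)]) simp
qed

text \<open>As the derivatives by \<open>x\<close> treat \<open>b\<close> as constant, the parameters may be replaced by
  their values before or after differentiation.\<close>

lemma restrict_F1_parameters:
  assumes "\<And>\<nu>. \<nu> \<le> \<mu> - 2 \<Longrightarrow> \<gamma> (b_index n \<nu>) = [:bh \<nu>:]"
  shows "restrict_to_arc \<gamma> (F1 \<mu> F (\<lambda>\<nu>. mp_var (b_index n \<nu>)) i) =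
      restrict_to_arc \<gamma> (F1 \<mu> F (\<lambda>\<nu>. mp_const (bh \<nu>)) i)"
    and "l < n \<Longrightarrow> restrict_to_arc \<gamma> (mp_pderiv l (F1 \<mu> F (\<lambda>\<nu>. mp_var (b_index n \<nu>)) i)) =
      restrict_to_arc \<gamma> (mp_pderiv l (F1 \<mu> F (\<lambda>\<nu>. mp_const (bh \<nu>)) i))"
proof -
  interpret S: mp_substitution "\<lambda>c::real. [:c:]" \<gamma> by (rule mp_substitution_arc)
  show "restrict_to_arc \<gamma> (F1 \<mu> F (\<lambda>\<nu>. mp_var (b_index n \<nu>)) i) =
      restrict_to_arc \<gamma> (F1 \<mu> F (\<lambda>\<nu>. mp_const (bh \<nu>)) i)"
    unfolding F1_def
    by (simp add: S.hom_minus S.hom_sum S.hom_mult S.subst_const S.subst_var assms)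
  show "restrict_to_arc \<gamma> (mp_pderiv l (F1 \<mu> F (\<lambda>\<nu>. mp_var (b_index n \<nu>)) i)) =
      restrict_to_arc \<gamma> (mp_pderiv l (F1 \<mu> F (\<lambda>\<nu>. mp_const (bh \<nu>)) i))" if "l < n"
  proof -
    have "mp_pderiv l (mp_var (b_index n \<nu>)) = 0" for \<nu>
      using that by (simp add: mp_pderiv_var b_index_def)
    then show ?thesis
      unfolding F1_def
      by (simp add: mp_pderiv_diff mp_pderiv_sum mp_pderiv_mult S.hom_minus S.hom_sum S.hom_mult
          S.hom_add S.subst_const S.subst_var assms S.hom_zero)
  qed
qed

lemma coeff_deflation_arc_0: "coeff (deflation_arc n \<mu> y l) 0 = y l"
  by (simp add: deflation_arc_def coeff_map_poly mp_eval.hom_zero coeff_jet_0)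

lemma deflation_arc_parameter: "n \<le> v \<Longrightarrow> deflation_arc n \<mu> y v = [:y v:]"
  by (simp add: deflation_arc_def jet_def map_poly_pCons mp_eval.hom_zero)

lemma degree_deflation_arc: "1 \<le> \<mu> \<Longrightarrow> degree (deflation_arc n \<mu> y l) \<le> \<mu> - 1"
  by (rule degree_le) (auto simp: deflation_arc_def coeff_map_poly mp_eval.hom_zero coeff_jet_beyond)

lemma deflation_arc_first:
  assumes "1 \<le> n" "2 \<le> \<mu>"
  shows "deflation_arc n \<mu> y 0 = [:y 0, 1:]"
proof (rule poly_eqI)
  fix j
  have *: "coeff (deflation_arc n \<mu> y 0) j = mp_eval (coeff (jet n \<mu> (a_par n \<mu>) 0) j) y"
    by (simp add: deflation_arc_def coeff_map_poly mp_eval.hom_zero)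
  consider "j = 0" | "1 \<le> j" "j < \<mu>" | "1 \<le> j" "\<mu> \<le> j" by linarith
  then show "coeff (deflation_arc n \<mu> y 0) j = coeff [:y 0, 1:] j"
  proof cases
    case 1 then show ?thesis by (simp add: coeff_deflation_arc_0)
  next
    case 2
    then show ?thesis
      unfolding * using assms
      by (auto simp: coeff_jet a_par_def mp_eval.hom_one mp_eval.hom_zero coeff_pCons split: nat.splits)
  next
    case 3
    then show ?thesis
      unfolding * using assms
      by (auto simp: coeff_jet_beyond mp_eval.hom_zero coeff_pCons split: nat.splits)
  qed
qed

lemma smult_sum_right: "Polynomial.smult c (\<Sum>x\<in>A. f x) = (\<Sum>x\<in>A. Polynomial.smult c (f x))"
  by (induction A rule: infinite_finite_induct) (simp_all add: smult_add_right)

text \<open>Nonsingularity of the Jacobian matrix, expressed by its kernel in order to avoid vectors of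
  dimension \<open>\<mu> n\<close> with mixed indices.\<close>

definition injective_jacobian :: "nat \<Rightarrow> (nat \<Rightarrow> mpoly) \<Rightarrow> (nat \<Rightarrow> real) \<Rightarrow> bool" where
  "injective_jacobian N G y \<longleftrightarrow> (\<forall>v.
     (\<forall>m<N. (\<Sum>j<N. mp_eval (mp_pderiv j (G m)) y * v j) = 0) \<longrightarrow> (\<forall>j<N. v j = 0))"

locale deflation_point =
  fixes n \<mu> :: nat and F :: "nat \<Rightarrow> mpoly" and y bh :: "nat \<Rightarrow> real"
  assumes n: "1 \<le> n" and \<mu>: "2 \<le> \<mu>"
    and F: "\<And>i. i < n \<Longrightarrow> mp_vars (F i) \<subseteq> {..<n}"
    and bh: "\<And>\<nu>. \<nu> \<le> \<mu> - 2 \<Longrightarrow> y (b_index n \<nu>) = bh \<nu>"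
begin

abbreviation "F0 \<equiv> F1 \<mu> F (\<lambda>\<nu>. mp_const (bh \<nu>))"
abbreviation "arc \<equiv> deflation_arc n \<mu> y"

lemma arc_b_index: "\<nu> \<le> \<mu> - 2 \<Longrightarrow> arc (b_index n \<nu>) = [:bh \<nu>:]"
  by (simp add: deflation_arc_parameter b_index_def flip: bh)

lemma mp_vars_F0: "i < n \<Longrightarrow> mp_vars (F0 i) \<subseteq> {..<n}"
  using n by (intro mp_vars_F1 F) auto

lemma root_imp_order:
  assumes root: "is_root (\<mu> * n) (deflated_system n \<mu> F) y" and "i < n" "m < \<mu>"
  shows "coeff (restrict_to_arc arc (F0 i)) m = 0"
proof -
  have "m * n + i < \<mu> * n"
  proof -
    have "m * n + i < Suc m * n" using assms(2) by simp
    also have "\<dots> \<le> \<mu> * n" using assms(3) by (intro mult_right_mono) auto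
    finally show ?thesis .
  qed
  then have "mp_eval (deflated_system n \<mu> F (m * n + i)) y = 0"
    using root by (simp add: is_root_def)
  then show ?thesis
    using assms(2,3) restrict_F1_parameters(1)[of \<mu> arc n bh, OF arc_b_index]
    by (simp add: deflated_system_def mp_eval_L_op)
qed

text \<open>A deformation of the arc that keeps the contact to first order is a kernel vector of \<open>J\<^sub>G\<close>.\<close>

lemma tangent_arc_eq_0:
  assumes inj: "injective_jacobian (\<mu> * n) (deflated_system n \<mu> F) y"
    and deg: "\<And>l. l < n \<Longrightarrow> degree (\<Delta> l) < \<mu>" "degree (\<Delta> 0) = 0"
    and tangent: "\<And>i m. i < n \<Longrightarrow> m < \<mu> \<Longrightarrow>
      coeff (\<Sum>l<n. restrict_to_arc arc (mp_pderiv l (F0 i)) * \<Delta> l) m = 0"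
    and "l < n"
  shows "\<Delta> l = 0"
proof -
  let ?H = "F1 \<mu> F (\<lambda>\<nu>. mp_var (b_index n \<nu>))"
  have kernel: "(\<Sum>v<\<mu> * n. mp_eval (mp_pderiv v (deflated_system n \<mu> F m)) y * unknown_tangent n \<mu> \<Delta> v) = 0"
    if m: "m < \<mu> * n" for m
  proof -
    have i: "m mod n < n" and k: "m div n < \<mu>"
      using m n by (auto simp: less_mult_imp_div_less)
    have "mp_vars (?H (m mod n)) \<subseteq> {..<n + (\<mu> - 1)}"
      using F[OF i] n \<mu> by (intro mp_vars_F1) (auto simp: b_index_def)
    from directional_derivative_L_op[where H = ?H and i = "m mod n" and \<Delta> = \<Delta>, OF k this deg \<mu> n, where y = y]
    show ?thesis
      using tangent[OF i k] restrict_F1_parameters(2)[of \<mu> arc n bh _ F, OF arc_b_index]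
      by (simp add: deflated_system_def)
  qed
  then have zero: "unknown_tangent n \<mu> \<Delta> v = 0" if "v < \<mu> * n" for v
    using inj that unfolding injective_jacobian_def by blast
  have nN: "n \<le> \<mu> * n" using \<mu> by simp
  show ?thesis
  proof (rule poly_eqI)
    fix j
    consider "j = 0" | "1 \<le> j" "j < \<mu>" "l \<noteq> 0" | "degree (\<Delta> l) < j"
      using deg(1)[OF \<open>l < n\<close>] deg(2) by (cases "l = 0") (fastforce, linarith)
    then show "coeff (\<Delta> l) j = coeff 0 j"
    proof cases
      case 1
      then show ?thesis
        using zero[of l] \<open>l < n\<close> nN by (simp add: unknown_tangent_def)
    next
      case 2
      then show ?thesis
        using zero[of "a_index n \<mu> (Suc j) l"] a_index_less[of l n "Suc j" \<mu>]
          unknown_tangent_a_index[of l n "Suc j" \<mu> \<Delta>] \<open>l < n\<close> by simp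
    next
      case 3
      then show ?thesis by (simp add: coeff_eq_0)
    qed
  qed
qed

text \<open>For the deformation \<open>\<Delta> = w\<^sub>0 \<gamma>' + \<mu> (0, w\<^sub>1, \<dots>) t\<^sup>\<mu>\<^sup>-\<^sup>1\<close> the change of \<open>F\<^sub>0(\<gamma>(t))\<close> is
  \<open>w\<^sub>0 d/dt F\<^sub>0(\<gamma>(t))\<close> plus a term of order \<open>\<mu> - 1\<close>. Both have order at least \<open>\<mu> - 1\<close>, and their
  coefficients of \<open>t\<^sup>\<mu>\<^sup>-\<^sup>1\<close> add up to \<open>\<mu>\<close> times the left-hand side of the hypothesis on \<open>w\<close>.\<close>

lemma contact_matrix_injective:
  assumes root: "is_root (\<mu> * n) (deflated_system n \<mu> F) y"
    and inj: "injective_jacobian (\<mu> * n) (deflated_system n \<mu> F) y"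
    and w: "\<And>i. i < n \<Longrightarrow> w 0 * coeff (restrict_to_arc arc (F0 i)) \<mu> +
      (\<Sum>l=1..<n. mp_eval (mp_pderiv l (F0 i)) y * w l) = 0"
    and "l < n"
  shows "w l = 0"
proof -
  define \<Delta> where "\<Delta> l = Polynomial.smult (w 0) (pderiv (arc l)) +
      (if l = 0 then 0 else monom (real \<mu> * w l) (\<mu> - 1))" for l
  have \<Delta>0: "\<Delta> 0 = [:w 0:]"
    using n \<mu> by (simp add: \<Delta>_def deflation_arc_first pderiv_pCons)
  have "\<Delta> l = 0" if "l < n" for l
  proof (rule tangent_arc_eq_0[where \<Delta> = \<Delta>, OF inj _ _ _ that])
    show "degree (\<Delta> l) < \<mu>" for l
    proof -
      have "degree (\<Delta> l) \<le> \<mu> - 1"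
        unfolding \<Delta>_def using degree_deflation_arc[of \<mu> n y l] \<mu>
        by (intro degree_add_le) (auto intro!: order_trans[OF degree_smult_le]
            simp: degree_pderiv degree_monom_le)
      then show ?thesis using \<mu> by linarith
    qed
    show "degree (\<Delta> 0) = 0" by (simp add: \<Delta>0)
    fix i m assume i: "i < n" and m: "m < \<mu>"
    let ?\<phi> = "restrict_to_arc arc"
    have "(\<Sum>l<n. ?\<phi> (mp_pderiv l (F0 i)) * \<Delta> l) =
        Polynomial.smult (w 0) (\<Sum>l<n. ?\<phi> (mp_pderiv l (F0 i)) * pderiv (arc l)) +
        (\<Sum>l<n. ?\<phi> (mp_pderiv l (F0 i)) * (if l = 0 then 0 else monom (real \<mu> * w l) (\<mu> - 1)))"
      by (simp add: \<Delta>_def distrib_left sum.distrib smult_sum_right)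
    also have "(\<Sum>l<n. ?\<phi> (mp_pderiv l (F0 i)) * pderiv (arc l)) = pderiv (?\<phi> (F0 i))"
      using pderiv_restrict_to_arc[OF mp_vars_F0[OF i], of arc] by simp
    also have "(\<Sum>l<n. ?\<phi> (mp_pderiv l (F0 i)) * (if l = 0 then 0 else monom (real \<mu> * w l) (\<mu> - 1))) =
        (\<Sum>l=1..<n. ?\<phi> (mp_pderiv l (F0 i)) * monom (real \<mu> * w l) (\<mu> - 1))"
      by (intro sum.mono_neutral_cong_right) auto
    finally have *: "coeff (\<Sum>l<n. ?\<phi> (mp_pderiv l (F0 i)) * \<Delta> l) m =
        w 0 * (real (Suc m) * coeff (?\<phi> (F0 i)) (Suc m)) +
        (\<Sum>l=1..<n. coeff (?\<phi> (mp_pderiv l (F0 i)) * monom (real \<mu> * w l) (\<mu> - 1)) m)"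
      by (simp add: coeff_pderiv coeff_sum)
    show "coeff (\<Sum>l<n. ?\<phi> (mp_pderiv l (F0 i)) * \<Delta> l) m = 0"
    proof (cases "Suc m = \<mu>")
      case False
      then show ?thesis
        unfolding * using m root_imp_order[OF root i, of "Suc m"]
        by (simp add: coeff_monom_mult mult.commute[of _ "monom _ _"])
    next
      case True
      have "coeff (?\<phi> (mp_pderiv l (F0 i)) * monom (real \<mu> * w l) (\<mu> - 1)) m =
          real \<mu> * (mp_eval (mp_pderiv l (F0 i)) y * w l)" for l
        using True
        by (simp add: coeff_monom_mult mult.commute[of _ "monom _ _"]
            coeff_0_restrict_to_arc[OF coeff_deflation_arc_0])
      then have "coeff (\<Sum>l<n. ?\<phi> (mp_pderiv l (F0 i)) * \<Delta> l) m =
          real \<mu> * (w 0 * coeff (?\<phi> (F0 i)) \<mu> + (\<Sum>l=1..<n. mp_eval (mp_pderiv l (F0 i)) y * w l))"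
        unfolding * using True by (simp add: sum_distrib_left distrib_left)
      then show ?thesis using w[OF i] by simp
    qed
  qed
  then have zero: "\<Delta> l = 0" if "l < n" for l using that .
  have "w 0 = 0" using zero[of 0] n by (simp add: \<Delta>0)
  with zero[OF \<open>l < n\<close>] \<mu> show ?thesis
    by (cases "l = 0") (simp_all add: \<Delta>_def)
qed

end

section \<open>The verification condition\<close>

lemma zero_in_interval: "(0::real) \<in>\<^sub>i 0"
  by (simp add: set_of_eq)

lemma sum_in_interval:
  fixes f :: "'a \<Rightarrow> real"
  assumes "\<And>j. j \<in> A \<Longrightarrow> f j \<in>\<^sub>i X j"
  shows "(\<Sum>j\<in>A. f j) \<in>\<^sub>i (\<Sum>j\<in>A. X j)"
  using assms
  by (induction A rule: infinite_finite_induct) (auto simp: zero_in_interval intro!: plus_in_intervalI)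

lemma interior_real_interval_subset: "interior {a..b} \<subseteq> {a<..<b::real}"
proof
  fix x assume "x \<in> interior {a..b}"
  then obtain T where T: "open T" "x \<in> T" "T \<subseteq> {a..b}" by (rule interiorE)
  then obtain e where e: "e > 0" "\<And>y. dist y x < e \<Longrightarrow> y \<in> T"
    unfolding open_dist by blast
  have "x - e / 2 \<in> T" "x + e / 2 \<in> T" using e by (simp_all add: dist_real_def)
  then have "a \<le> x - e / 2" "x + e / 2 \<le> b" using T(3) by auto
  with e(1) show "x \<in> {a<..<b}" by simp
qed

text \<open>Let \<open>w\<close> be the vector of widths of the box. Comparing two opposite vertices of the box shows
  that \<open>\<bar>C\<bar> w < w\<close> in every component. In the maximum norm weighted by \<open>w\<close>, the matrix \<open>C\<close> has
  therefore norm below 1, and it cannot have the eigenvalue 1.\<close>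

lemma self_mapping_box_contracts:
  fixes C :: "nat \<Rightarrow> nat \<Rightarrow> real"
  assumes maps: "\<And>i z. i < N \<Longrightarrow> (\<And>j. j < N \<Longrightarrow> l j \<le> z j \<and> z j \<le> u j) \<Longrightarrow>
      l i < c i + (\<Sum>j<N. C i j * z j) \<and> c i + (\<Sum>j<N. C i j * z j) < u i"
    and nonempty: "\<And>j. j < N \<Longrightarrow> l j \<le> u j"
    and fixed: "\<And>i. i < N \<Longrightarrow> (\<Sum>j<N. C i j * v j) = v i"
    and "k < N"
  shows "v k = 0"
proof -
  let ?w = "\<lambda>j. u j - l j"
  have contr: "(\<Sum>j<N. \<bar>C i j\<bar> * ?w j) < ?w i" if "i < N" for i
  proof -
    \<comment> \<open>the vertices at which the \<open>i\<close>-th component of \<open>C z\<close> is maximal and minimal\<close>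
    let ?z = "\<lambda>j. if C i j \<ge> 0 then u j else l j" and ?z' = "\<lambda>j. if C i j \<ge> 0 then l j else u j"
    have "(\<Sum>j<N. \<bar>C i j\<bar> * ?w j) = (\<Sum>j<N. C i j * ?z j) - (\<Sum>j<N. C i j * ?z' j)"
      unfolding sum_subtractf[symmetric] by (intro sum.cong) (auto simp: algebra_simps)
    also have "\<dots> < ?w i"
    proof -
      have "c i + (\<Sum>j<N. C i j * ?z j) < u i" "l i < c i + (\<Sum>j<N. C i j * ?z' j)"
        using maps[OF that, of ?z] maps[OF that, of ?z'] nonempty by simp_all
      then show ?thesis by linarith
    qed
    finally show ?thesis .
  qed
  have w_pos: "?w i > 0" if "i < N" for i
  proof -
    have "0 \<le> (\<Sum>j<N. \<bar>C i j\<bar> * ?w j)" using nonempty by (intro sum_nonneg) auto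
    with contr[OF that] show ?thesis by linarith
  qed
  define r where "r = Max ((\<lambda>j. \<bar>v j\<bar> / ?w j) ` {..<N})"
  have r_ge: "\<bar>v j\<bar> \<le> r * ?w j" if "j < N" for j
  proof -
    have "\<bar>v j\<bar> / ?w j \<le> r" unfolding r_def using that by (intro Max_ge) auto
    then show ?thesis using w_pos[OF that] by (simp add: field_simps)
  qed
  have "r \<in> (\<lambda>j. \<bar>v j\<bar> / ?w j) ` {..<N}"
    unfolding r_def using \<open>k < N\<close> by (intro Max_in) auto
  then obtain i where i: "i < N" "r = \<bar>v i\<bar> / ?w i" by blast
  have "r \<le> 0"
  proof (rule ccontr)
    assume "\<not> r \<le> 0"
    then have "r > 0" by simp
    have "\<bar>v i\<bar> \<le> (\<Sum>j<N. \<bar>C i j\<bar> * \<bar>v j\<bar>)"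
      using sum_abs[of "\<lambda>j. C i j * v j" "{..<N}"] fixed[OF i(1)] by (simp add: abs_mult)
    also have "\<dots> \<le> (\<Sum>j<N. \<bar>C i j\<bar> * (r * ?w j))"
      by (intro sum_mono mult_left_mono r_ge) auto
    also have "\<dots> = r * (\<Sum>j<N. \<bar>C i j\<bar> * ?w j)"
      by (simp add: sum_distrib_left mult.left_commute)
    also have "\<dots> < r * ?w i" using contr[OF i(1)] \<open>r > 0\<close> by simp
    also have "\<dots> = \<bar>v i\<bar>" using i w_pos[OF i(1)] by simp
    finally show False by simp
  qed
  then have "r * ?w k \<le> 0" using w_pos[OF \<open>k < N\<close>] by (simp add: mult_le_0_iff)
  with r_ge[OF \<open>k < N\<close>] show ?thesis by simp
qed

text \<open>A kernel vector of the Jacobian matrix \<open>J\<close> at \<open>y\<close>, which is a member of \<open>M\<close>, is fixed by the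
  matrix \<open>C = I - A J\<close>, where \<open>A\<close> is the preconditioner.\<close>

theorem verification_imp_injective_jacobian:
  assumes app: "verification_applicable N G yt Y M" and box: "in_box N y Y"
  shows "injective_jacobian N G y"
  unfolding injective_jacobian_def
proof (intro allI impI)
  fix v k assume kernel: "\<forall>m<N. (\<Sum>j<N. mp_eval (mp_pderiv j (G m)) y * v j) = 0"
    and "k < N"
  define A where "A i k = jacobian N G yt $$ (i, k)" for i k
  define J where "J k j = mp_eval (mp_pderiv j (G k)) y" for k j
  define C where "C i j = (if i = j then 1 else 0) - (\<Sum>k<N. A i k * J k j)" for i j
  define c where "c i = - (\<Sum>k<N. A i k * mp_eval (G k) yt)" for i
  have J: "J k j \<in>\<^sub>i M k j" if "k < N" "j < N" for k j
    using app box that by (auto simp: verification_applicable_def J_def)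
  have op: "c i + (\<Sum>j<N. C i j * z j) \<in>\<^sub>i verification_operator N G yt Y M i"
    if z: "\<And>j. j < N \<Longrightarrow> z j \<in>\<^sub>i Y j" for i z
    unfolding verification_operator_def c_def C_def A_def
    using z J
    by (intro plus_in_intervalI sum_in_interval times_in_intervalI minus_in_intervalI
        in_interval_to_interval) auto
  show "v k = 0"
  proof (rule self_mapping_box_contracts[where l = "\<lambda>j. lower (Y j)" and u = "\<lambda>j. upper (Y j)"
        and C = C and c = c and N = N and v = v, OF _ _ _ \<open>k < N\<close>])
    fix i z assume i: "i < N" and "\<And>j. j < N \<Longrightarrow> lower (Y j) \<le> z j \<and> z j \<le> upper (Y j)"
    then have "c i + (\<Sum>j<N. C i j * z j) \<in>\<^sub>i verification_operator N G yt Y M i"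
      by (intro op) (simp add: set_of_eq)
    then have "c i + (\<Sum>j<N. C i j * z j) \<in> interior (set_of (Y i))"
      using app i by (auto simp: verification_applicable_def)
    then show "lower (Y i) < c i + (\<Sum>j<N. C i j * z j) \<and> c i + (\<Sum>j<N. C i j * z j) < upper (Y i)"
      using interior_real_interval_subset[of "lower (Y i)" "upper (Y i)"]
      by (auto simp: set_of_eq)
  next
    fix i assume i: "i < N"
    have "(\<Sum>j<N. C i j * v j) =
        (\<Sum>j<N. (if i = j then 1 else 0) * v j) - (\<Sum>j<N. \<Sum>k<N. A i k * (J k j * v j))"
      by (simp add: C_def left_diff_distrib sum_subtractf sum_distrib_right mult.assoc)
    also have "(\<Sum>j<N. \<Sum>k<N. A i k * (J k j * v j)) = (\<Sum>k<N. A i k * (\<Sum>j<N. J k j * v j))"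
      by (subst sum.swap) (simp add: sum_distrib_left)
    also have "\<dots> = 0" using kernel by (simp add: J_def)
    also have "(\<Sum>j<N. (if i = j then 1 else 0) * v j) = (\<Sum>j<N. if j = i then v j else 0)"
      by (intro sum.cong) auto
    also have "\<dots> = v i" using i by simp
    finally show "(\<Sum>j<N. C i j * v j) = v i" by simp
  qed simp
qed

section \<open>Systems with nondegenerate contact with an arc\<close>

lemma det_closed:
  assumes S: "closed_subring S" and A: "A \<in> carrier_mat n n"
    and entries: "\<And>i j. i < n \<Longrightarrow> j < n \<Longrightarrow> A $$ (i, j) \<in> S"
  shows "det A \<in> S"
  unfolding det_def'[OF A]
proof (intro closed_subring_sum[OF S] closed_subringD(6)[OF S] closed_subring_prod[OF S])
  fix p i assume p: "p \<in> {p. p permutes {0..<n}}" and i: "i \<in> {0..<n}"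
  then have "p i < n" using permutes_in_image[of p "{0..<n}" i] by simp
  then show "A $$ (i, p i) \<in> S" using entries i by simp
next
  fix p :: "nat \<Rightarrow> nat"
  show "signof p \<in> S"
    using closed_subringD(1,3)[OF S] by (auto simp: sign_def)
qed

lemma adj_mat_closed:
  assumes S: "closed_subring S" and A: "A \<in> carrier_mat n n"
    and entries: "\<And>i j. i < n \<Longrightarrow> j < n \<Longrightarrow> A $$ (i, j) \<in> S"
    and "i < n" "j < n"
  shows "adj_mat A $$ (i, j) \<in> S"
proof -
  have "det (mat_delete A j i) \<in> S"
    by (rule det_closed[OF S, where n = "n - 1"])
      (use A entries in \<open>auto simp: mat_delete_def\<close>)
  moreover have "- 1 \<in> S" using closed_subringD(1,3)[OF S] by blast
  ultimately show ?thesis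
    using A assms(4,5)
    by (auto simp: adj_mat_def cofactor_def intro!: closed_subringD(6)[OF S] closed_subring_power[OF S])
qed

text \<open>Cramer's rule over a commutative ring: multiplication by the adjugate matrix recovers \<open>det A b\<close>
  from \<open>A b\<close>.\<close>

lemma det_combination_cramer:
  fixes b :: "nat \<Rightarrow> 'a::comm_ring_1"
  assumes A: "A \<in> carrier_mat n n" and "k < n"
  shows "(\<Sum>i<n. adj_mat A $$ (k, i) * (\<Sum>j<n. A $$ (i, j) * b j)) = det A * b k"
proof -
  have adj: "adj_mat A \<in> carrier_mat n n" "adj_mat A * A = det A \<cdot>\<^sub>m 1\<^sub>m n"
    using adj_mat[OF A] by auto
  have entry: "(\<Sum>i<n. adj_mat A $$ (k, i) * A $$ (i, j)) = (if j = k then det A else 0)" if "j < n" for j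
  proof -
    have "(\<Sum>i<n. adj_mat A $$ (k, i) * A $$ (i, j)) = (adj_mat A * A) $$ (k, j)"
      using A adj(1) that \<open>k < n\<close> by (simp add: scalar_prod_def atLeast0LessThan)
    then show ?thesis using adj(2) that \<open>k < n\<close> by auto
  qed
  have "(\<Sum>i<n. adj_mat A $$ (k, i) * (\<Sum>j<n. A $$ (i, j) * b j)) =
      (\<Sum>j<n. (\<Sum>i<n. adj_mat A $$ (k, i) * A $$ (i, j)) * b j)"
    unfolding sum_distrib_left sum_distrib_right by (subst sum.swap) (simp add: mult.assoc)
  also have "\<dots> = (\<Sum>j<n. if j = k then det A * b j else 0)"
    by (intro sum.cong) (auto simp: entry)
  also have "\<dots> = det A * b k" using \<open>k < n\<close> by simp
  finally show ?thesis .
qed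

lemma low_order_factor:
  fixes p q :: "'a::idom poly"
  assumes "monom 1 \<mu> dvd p * q" "coeff q 0 \<noteq> 0"
  shows "monom 1 \<mu> dvd p"
  unfolding monom_1_dvd_iff'
proof (intro allI impI)
  fix k assume "k < \<mu>"
  then show "coeff p k = 0"
  proof (induction k rule: less_induct)
    case (less k)
    have "0 = coeff (p * q) k" using assms(1) less(2) by (simp add: monom_1_dvd_iff')
    also have "\<dots> = (\<Sum>i\<le>k. if i = k then coeff p k * coeff q 0 else 0)"
      unfolding coeff_mult using less by (intro sum.cong) auto
    finally show ?case using assms(2) by simp
  qed
qed

lemma tendsto_mp_eval:
  assumes "\<And>i. i \<in> mp_vars p \<Longrightarrow> ((\<lambda>k. z k i) \<longlongrightarrow> x i) F"
  shows "((\<lambda>k. mp_eval p (z k)) \<longlongrightarrow> mp_eval p x) F"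
  unfolding mp_eval_def
  by (intro tendsto_intros assms) (auto simp: mp_vars_def)

lemma nat_pow_subset_ring: "a [^]\<^bsub>subset_ring S\<^esub> (k::nat) = a ^ k"
  by (induction k) (simp_all add: nat_pow_def mult.commute)

text \<open>The arc \<open>\<gamma>\<close> is parametrized by its first coordinate. The last assumption is the nonsingularity
  of the matrix that has the coefficients of \<open>t\<^sup>\<mu>\<close> of the \<open>f\<^sub>i(\<gamma>(t))\<close> as its first column and agrees with
  the Jacobian matrix of \<open>f\<close> at \<open>x\<close> in the others.\<close>

locale arc_contact =
  fixes n \<mu> :: nat and f :: "nat \<Rightarrow> mpoly" and \<gamma> :: "nat \<Rightarrow> real poly" and x :: "nat \<Rightarrow> real"
  assumes n: "1 \<le> n" and \<mu>: "2 \<le> \<mu>"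
    and f: "\<And>i. i < n \<Longrightarrow> mp_vars (f i) \<subseteq> {..<n}"
    and \<gamma>_0: "\<gamma> 0 = [:x 0, 1:]"
    and \<gamma>_x: "\<And>l. l < n \<Longrightarrow> coeff (\<gamma> l) 0 = x l"
    and contact: "\<And>i. i < n \<Longrightarrow> monom 1 \<mu> dvd restrict_to_arc \<gamma> (f i)"
    and nondegenerate: "\<And>w l. (\<And>i. i < n \<Longrightarrow> w 0 * coeff (restrict_to_arc \<gamma> (f i)) \<mu> +
      (\<Sum>l=1..<n. mp_eval (mp_pderiv l (f i)) x * w l) = 0) \<Longrightarrow> l < n \<Longrightarrow> w l = 0"
begin

abbreviation "\<rho> \<equiv> restrict_to_arc \<gamma>"
abbreviation "R \<equiv> {p. mp_vars p \<subseteq> {..<n}}"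

sublocale \<rho>: mp_substitution "\<lambda>c::real. [:c:]" \<gamma> by (rule mp_substitution_arc)

lemma coeff_\<rho>_0: "p \<in> R \<Longrightarrow> coeff (\<rho> p) 0 = mp_eval p x"
  by (rule coeff_0_restrict_to_arc) (auto intro: \<gamma>_x)

definition t :: mpoly where "t = mp_var 0 - mp_const (x 0)"

text \<open>A section of the restriction \<open>\<rho>\<close> to the arc: a polynomial in the curve parameter is read as a
  polynomial in \<open>x\<^sub>1\<close>.\<close>

definition \<iota> :: "real poly \<Rightarrow> mpoly" where "\<iota> h = poly (map_poly mp_const h) t"

sublocale \<iota>: comm_ring_hom \<iota>
proof -
  interpret M: comm_ring_hom "map_poly mp_const"
    by (intro comm_ring_hom_map_poly mp_const.comm_ring_hom_axioms)
  show "comm_ring_hom \<iota>"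
    by unfold_locales
      (simp_all add: \<iota>_def M.hom_add M.hom_mult M.hom_one M.hom_zero del: map_poly_1)
qed

lemma \<iota>_pCons: "\<iota> (pCons c h) = mp_const c + t * \<iota> h"
  by (simp add: \<iota>_def map_poly_pCons mp_const.hom_zero)

lemma \<iota>_const: "\<iota> [:c:] = mp_const c"
  by (simp add: \<iota>_pCons \<iota>.hom_zero)

lemma \<iota>_monom: "\<iota> (monom 1 k) = t ^ k"
  by (simp add: monom_altdef \<iota>.hom_power \<iota>_pCons \<iota>.hom_zero mp_const.hom_zero mp_const.hom_one)

lemma \<rho>_t: "\<rho> t = [:0, 1:]"
  by (simp add: t_def \<rho>.hom_minus \<rho>.subst_const \<rho>.subst_var \<gamma>_0)

lemma \<rho>_\<iota>: "\<rho> (\<iota> h) = h"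
  by (induction h) (simp_all add: \<iota>_pCons \<iota>.hom_zero \<rho>.hom_zero \<rho>.hom_add \<rho>.hom_mult \<rho>.subst_const \<rho>_t)

lemma mp_eval_t: "mp_eval t z = z 0 - x 0"
  by (simp add: t_def mp_eval.hom_minus)

lemma mp_eval_\<iota>: "mp_eval (\<iota> h) z = poly h (z 0 - x 0)"
  by (induction h)
    (simp_all add: \<iota>_pCons \<iota>.hom_zero mp_eval.hom_zero mp_eval.hom_add mp_eval.hom_mult mp_eval_t)

lemma mp_vars_t: "mp_vars t \<subseteq> {0}"
  unfolding t_def by (rule mp_vars_subset_diff) simp_all

lemma mp_vars_\<iota>: "mp_vars (\<iota> h) \<subseteq> {0}"
  by (induction h)
    (simp_all add: \<iota>_pCons \<iota>.hom_zero mp_vars_subset_add mp_vars_subset_mult mp_vars_t)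

lemma closed_R: "closed_subring R" by (rule closed_subring_mp)

lemma \<iota>_in_R: "\<iota> h \<in> R" and t_in_R: "t \<in> R"
  using mp_vars_\<iota>[of h] mp_vars_t n by auto

text \<open>The ideal of the polynomials that vanish to order \<open>\<mu>\<close> along the arc.\<close>

definition Q :: "mpoly set" where "Q = {p \<in> R. monom 1 \<mu> dvd \<rho> p}"

text \<open>Generators of \<open>Q\<close>: the equations of the curve and, at index 0, the condition on the order.\<close>

definition gen :: "nat \<Rightarrow> mpoly" where
  "gen j = (if j = 0 then t ^ \<mu> else mp_var j - \<iota> (\<gamma> j))"

lemma \<rho>_gen: "\<rho> (gen j) = (if j = 0 then monom 1 \<mu> else 0)"
  by (simp add: gen_def \<rho>.hom_power \<rho>_t \<rho>.hom_minus \<rho>.subst_var \<rho>_\<iota> monom_altdef)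

lemma gen_in_R:
  assumes "j < n" shows "gen j \<in> R"
proof -
  have "mp_var j \<in> R" using assms by simp
  then show ?thesis
    unfolding gen_def
    using closed_subring_power[OF closed_R t_in_R] closed_subringD(5)[OF closed_R _ \<iota>_in_R] by presburger
qed

lemma mp_eval_gen: "j < n \<Longrightarrow> mp_eval (gen j) x = 0"
  using coeff_\<rho>_0[OF gen_in_R[of j]] \<mu> by (simp add: \<rho>_gen split: if_splits)

text \<open>Modulo the equations of the curve every variable, and hence every polynomial, is a polynomial
  in \<open>t\<close>.\<close>

lemma R_modulo_arc:
  assumes "p \<in> R"
  shows "\<exists>B. (\<forall>j. B j \<in> R) \<and> p - \<iota> (\<rho> p) = (\<Sum>j\<in>{1..<n}. B j * gen j)"
proof -
  let ?S = "{p. \<exists>B. (\<forall>j. B j \<in> R) \<and> p = (\<Sum>j\<in>{1..<n}. B j * gen j)}"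
  have S_add: "p + q \<in> ?S" if "p \<in> ?S" "q \<in> ?S" for p q
  proof -
    from that obtain B C where "\<forall>j. B j \<in> R" "\<forall>j. C j \<in> R"
      "p = (\<Sum>j\<in>{1..<n}. B j * gen j)" "q = (\<Sum>j\<in>{1..<n}. C j * gen j)" by auto
    then show ?thesis
      using closed_subringD(4)[OF closed_R]
      by (intro CollectI exI[of _ "\<lambda>j. B j + C j"]) (simp add: distrib_right sum.distrib)
  qed
  have S_mult: "r * p \<in> ?S" if "r \<in> R" "p \<in> ?S" for r p
  proof -
    from that(2) obtain B where "\<forall>j. B j \<in> R" "p = (\<Sum>j\<in>{1..<n}. B j * gen j)" by auto
    then show ?thesis
      using closed_subringD(6)[OF closed_R that(1)]
      by (intro CollectI exI[of _ "\<lambda>j. r * B j"]) (simp add: sum_distrib_left mult.assoc)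
  qed
  have S_0: "0 \<in> ?S"
    using closed_subringD(2)[OF closed_R] by (intro CollectI exI[of _ "\<lambda>_. 0"]) simp
  from assms have "mp_vars p \<subseteq> {..<n}" by simp
  then have "p - \<iota> (\<rho> p) \<in> ?S"
  proof (induction rule: mp_induct)
    case (const c)
    show ?case using S_0 by (simp add: \<rho>.subst_const \<iota>_const)
  next
    case (var i)
    show ?case
    proof (cases "i = 0")
      case True
      have "mp_var 0 - \<iota> (\<rho> (mp_var 0)) = 0"
        by (simp add: \<rho>.subst_var \<gamma>_0 \<iota>_pCons \<iota>.hom_zero mp_const.hom_one t_def)
      then show ?thesis using True S_0 by simp
    next
      case False
      have "(\<Sum>j\<in>{1..<n}. (if j = i then 1 else 0) * gen j) = (\<Sum>j\<in>{1..<n}. if j = i then gen j else 0)"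
        by (intro sum.cong) auto
      also have "\<dots> = mp_var i - \<iota> (\<rho> (mp_var i))"
        using False var by (simp add: gen_def \<rho>.subst_var)
      finally show ?thesis
        using closed_subringD(1,2)[OF closed_R]
        by (intro CollectI exI[of _ "\<lambda>j. if j = i then 1 else 0"]) simp
    qed
  next
    case (add p q)
    have "p + q - \<iota> (\<rho> (p + q)) = (p - \<iota> (\<rho> p)) + (q - \<iota> (\<rho> q))"
      by (simp add: \<rho>.hom_add \<iota>.hom_add)
    then show ?case using S_add[OF add(3,4)] by (simp only:)
  next
    case (mult p q)
    have "p * q - \<iota> (\<rho> (p * q)) = p * (q - \<iota> (\<rho> q)) + \<iota> (\<rho> q) * (p - \<iota> (\<rho> p))"
      by (simp add: \<rho>.hom_mult \<iota>.hom_mult algebra_simps)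
    moreover have "p \<in> R" using mult(1) by simp
    ultimately show ?case
      using S_add[OF S_mult[OF _ mult(4)] S_mult[OF \<iota>_in_R mult(3)]] by (simp only:)
  qed
  then show ?thesis by simp
qed

lemma Q_generated:
  assumes "p \<in> Q"
  shows "\<exists>B. (\<forall>j. B j \<in> R) \<and> p = (\<Sum>j<n. B j * gen j)"
proof -
  obtain B where B: "\<forall>j. B j \<in> R" "p - \<iota> (\<rho> p) = (\<Sum>j\<in>{1..<n}. B j * gen j)"
    using R_modulo_arc[of p] assms by (auto simp: Q_def)
  obtain h where "\<rho> p = monom 1 \<mu> * h" using assms by (auto simp: Q_def)
  then have h: "\<iota> (\<rho> p) = \<iota> h * gen 0" by (simp add: \<iota>.hom_mult \<iota>_monom gen_def mult.commute)
  have "p = \<iota> h * gen 0 + (\<Sum>j\<in>{1..<n}. B j * gen j)" using B(2) h by (simp add: algebra_simps)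
  also have "\<dots> = (\<Sum>j<n. (if j = 0 then \<iota> h else B j) * gen j)"
  proof -
    have "{..<n} = insert 0 {1..<n}" using n by auto
    then show ?thesis by (auto intro!: sum.cong)
  qed
  finally show ?thesis
    using B(1) \<iota>_in_R[of h] by (intro exI[of _ "\<lambda>j. if j = 0 then \<iota> h else B j"]) auto
qed

definition gen_coeff :: "nat \<Rightarrow> nat \<Rightarrow> mpoly" where
  "gen_coeff i = (SOME B. (\<forall>j. B j \<in> R) \<and> f i = (\<Sum>j<n. B j * gen j))"

lemma gen_coeff:
  assumes "i < n"
  shows "gen_coeff i j \<in> R" "f i = (\<Sum>j<n. gen_coeff i j * gen j)"
proof -
  have "f i \<in> Q" using f[OF assms] contact[OF assms] by (simp add: Q_def)
  from someI_ex[OF Q_generated[OF this]]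
  show "gen_coeff i j \<in> R" "f i = (\<Sum>j<n. gen_coeff i j * gen j)" unfolding gen_coeff_def by auto
qed

text \<open>Along the arc all generators except \<open>t\<^sup>\<mu>\<close> vanish.\<close>

lemma mp_eval_gen_coeff_0:
  assumes "i < n" shows "mp_eval (gen_coeff i 0) x = coeff (\<rho> (f i)) \<mu>"
proof -
  have "\<rho> (f i) = (\<Sum>j<n. \<rho> (gen_coeff i j) * \<rho> (gen j))"
    by (subst gen_coeff(2)[OF assms]) (simp add: \<rho>.hom_sum \<rho>.hom_mult)
  also have "\<dots> = (\<Sum>j<n. if j = 0 then \<rho> (gen_coeff i 0) * monom 1 \<mu> else 0)"
    by (intro sum.cong) (auto simp: \<rho>_gen)
  also have "\<dots> = monom 1 \<mu> * \<rho> (gen_coeff i 0)" using n by (simp add: mult.commute)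
  finally show ?thesis
    using coeff_\<rho>_0[OF gen_coeff(1)[OF assms]] by (simp add: coeff_monom_mult)
qed

text \<open>At \<open>x\<close> all generators vanish, and the gradient of \<open>gen j\<close> in the directions other than the
  first is the \<open>j\<close>-th unit vector, or 0 for \<open>j = 0\<close>.\<close>

lemma mp_eval_gen_coeff_pos:
  assumes "i < n" "1 \<le> l" "l < n" shows "mp_eval (gen_coeff i l) x = mp_eval (mp_pderiv l (f i)) x"
proof -
  have pd: "mp_pderiv l (gen j) = (if j = l then 1 else 0)" if "j < n" for j
  proof (cases "j = 0")
    case True
    have "mp_vars (t ^ \<mu>) \<subseteq> {0}" by (intro mp_vars_subset_power mp_vars_t)
    then show ?thesis using True assms by (auto simp: gen_def intro!: mp_pderiv_eq_0)
  next
    case False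
    have "mp_pderiv l (\<iota> (\<gamma> j)) = 0"
      using mp_vars_\<iota>[of "\<gamma> j"] assms by (intro mp_pderiv_eq_0) auto
    then show ?thesis using False by (simp add: gen_def mp_pderiv_diff mp_pderiv_var)
  qed
  have "mp_eval (mp_pderiv l (f i)) x =
      (\<Sum>j<n. mp_eval (gen_coeff i j) x * mp_eval (mp_pderiv l (gen j)) x +
        mp_eval (mp_pderiv l (gen_coeff i j)) x * mp_eval (gen j) x)"
    by (subst gen_coeff(2)[OF assms(1)])
      (simp add: mp_pderiv_sum mp_pderiv_mult mp_eval.hom_sum mp_eval.hom_add mp_eval.hom_mult)
  also have "\<dots> = (\<Sum>j<n. if j = l then mp_eval (gen_coeff i j) x else 0)"
    by (intro sum.cong) (auto simp: pd mp_eval_gen mp_eval.hom_one mp_eval.hom_zero)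
  also have "\<dots> = mp_eval (gen_coeff i l) x" using assms by simp
  finally show ?thesis by simp
qed

definition contact_matrix :: "mpoly mat" where "contact_matrix = mat n n (\<lambda>(i, j). gen_coeff i j)"

text \<open>The element by which \<open>Q\<close> has to be multiplied to get into the ideal of the system.\<close>

definition denom :: mpoly where "denom = det contact_matrix"

lemma contact_matrix_at_root:
  "map_mat (\<lambda>p. mp_eval p x) contact_matrix =
    mat n n (\<lambda>(i, l). if l = 0 then coeff (\<rho> (f i)) \<mu> else mp_eval (mp_pderiv l (f i)) x)"
  by (rule eq_matI) (auto simp: contact_matrix_def mp_eval_gen_coeff_0 mp_eval_gen_coeff_pos)

lemma det_contact_matrix_at_root: "det (map_mat (\<lambda>p. mp_eval p x) contact_matrix) \<noteq> 0"
proof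
  let ?A = "map_mat (\<lambda>p. mp_eval p x) contact_matrix"
  assume "det ?A = 0"
  have A: "?A \<in> carrier_mat n n" by (simp add: contact_matrix_def)
  from det_0_iff_vec_prod_zero_field[OF A] \<open>det ?A = 0\<close>
  obtain v where v: "v \<in> carrier_vec n" "v \<noteq> 0\<^sub>v n" "?A *\<^sub>v v = 0\<^sub>v n" by blast
  have "v $ l = 0" if "l < n" for l
  proof (rule nondegenerate[of "\<lambda>l. v $ l", OF _ that])
    fix i assume i: "i < n"
    have "0 = (?A *\<^sub>v v) $ i" using v(3) i by simp
    also have "\<dots> = (\<Sum>l<n. ?A $$ (i, l) * v $ l)"
      using A v(1) i by (simp add: scalar_prod_def atLeast0LessThan)
    also have "{..<n} = insert 0 {1..<n}" using n by auto
    also have "(\<Sum>l\<in>\<dots>. ?A $$ (i, l) * v $ l) = v $ 0 * coeff (\<rho> (f i)) \<mu> +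
        (\<Sum>l=1..<n. mp_eval (mp_pderiv l (f i)) x * v $ l)"
      unfolding contact_matrix_at_root using i n by (simp add: mult.commute)
    finally show "v $ 0 * coeff (\<rho> (f i)) \<mu> +
        (\<Sum>l=1..<n. mp_eval (mp_pderiv l (f i)) x * v $ l) = 0" by simp
  qed
  then have "v = 0\<^sub>v n" using v(1) by (intro eq_vecI) auto
  with v(2) show False ..
qed

lemma denom_in_R: "denom \<in> R"
  unfolding denom_def
  by (rule det_closed[OF closed_R, of _ n]) (use gen_coeff(1) in \<open>auto simp: contact_matrix_def\<close>)

lemma mp_eval_denom: "mp_eval denom x \<noteq> 0"
  using det_contact_matrix_at_root by (simp add: denom_def)

lemma denom_gen:
  assumes "k < n"
  shows "\<exists>C. (\<forall>i<n. C i \<in> R) \<and> denom * gen k = (\<Sum>i<n. C i * f i)"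
proof (intro exI[of _ "\<lambda>i. adj_mat contact_matrix $$ (k, i)"] conjI allI impI)
  have A: "contact_matrix \<in> carrier_mat n n" by (simp add: contact_matrix_def)
  show "adj_mat contact_matrix $$ (k, i) \<in> R" if "i < n" for i
    by (rule adj_mat_closed[OF closed_R A]) (use gen_coeff(1) that assms in \<open>auto simp: contact_matrix_def\<close>)
  have "(\<Sum>i<n. adj_mat contact_matrix $$ (k, i) * f i) =
      (\<Sum>i<n. adj_mat contact_matrix $$ (k, i) * (\<Sum>j<n. contact_matrix $$ (i, j) * gen j))"
    by (intro sum.cong refl) (simp add: gen_coeff(2) contact_matrix_def)
  then show "denom * gen k = (\<Sum>i<n. adj_mat contact_matrix $$ (k, i) * f i)"
    using det_combination_cramer[OF A assms, of gen] by (simp add: denom_def)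
qed


lemma ideal_iff: "ideal I (mp_ring n) \<longleftrightarrow>
    I \<subseteq> R \<and> 0 \<in> I \<and> (\<forall>p\<in>I. \<forall>q\<in>I. p + q \<in> I) \<and> (\<forall>a\<in>R. \<forall>p\<in>I. a * p \<in> I)"
  unfolding mp_ring_eq_subset_ring by (rule ideal_subset_ring_iff[OF closed_R])

sublocale P: cring "mp_ring n"
  unfolding mp_ring_eq_subset_ring by (rule cring_subset_ring[OF closed_R])

lemma mp_ring_simps [simp]:
  "carrier (mp_ring n) = R" "monoid.mult (mp_ring n) = (*)" "one (mp_ring n) = 1"
  "zero (mp_ring n) = 0" "add (mp_ring n) = (+)"
  by (simp_all add: mp_ring_def)

lemma f_in_R: "f ` {..<n} \<subseteq> R" using f by auto

lemma system_ideal: "ideal (system_ideal n f) (mp_ring n)" "f ` {..<n} \<subseteq> system_ideal n f"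
  using P.genideal_ideal[of "f ` {..<n}"] P.genideal_self[of "f ` {..<n}"] f_in_R
  by (simp_all add: system_ideal_def)

lemma system_ideal_minimal:
  "ideal I (mp_ring n) \<Longrightarrow> f ` {..<n} \<subseteq> I \<Longrightarrow> system_ideal n f \<subseteq> I"
  unfolding system_ideal_def by (rule P.genideal_minimal)

lemma ideal_sum_closed:
  assumes "ideal I (mp_ring n)" "\<And>i. i \<in> A \<Longrightarrow> c i \<in> R" "\<And>i. i \<in> A \<Longrightarrow> g i \<in> I"
  shows "(\<Sum>i\<in>A. c i * g i) \<in> I"
proof -
  have I: "0 \<in> I" "\<And>p q. p \<in> I \<Longrightarrow> q \<in> I \<Longrightarrow> p + q \<in> I" "\<And>a p. a \<in> R \<Longrightarrow> p \<in> I \<Longrightarrow> a * p \<in> I"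
    using assms(1) unfolding ideal_iff by blast+
  show ?thesis
    using assms(2,3)
  proof (induction A rule: infinite_finite_induct)
    case (insert i A)
    have "c i * g i + (\<Sum>i\<in>A. c i * g i) \<in> I"
      by (intro I(2,3) insert.IH insert.prems) auto
    then show ?case using insert(1,2) by simp
  qed (simp_all add: I(1))
qed

lemma denom_Q:
  assumes "p \<in> Q" shows "denom * p \<in> system_ideal n f"
proof -
  obtain A where A: "\<And>j. A j \<in> R" "p = (\<Sum>j<n. A j * gen j)"
    using Q_generated[OF assms] by blast
  have "denom * gen j \<in> system_ideal n f" if j: "j < n" for j
  proof -
    from denom_gen[OF j] obtain C where
      C: "\<forall>i<n. C i \<in> R" "denom * gen j = (\<Sum>i<n. C i * f i)" by (elim exE conjE)
    show ?thesis
      unfolding C(2) by (rule ideal_sum_closed[OF system_ideal(1)]) (use C(1) system_ideal(2) in auto)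
  qed
  then have "(\<Sum>j<n. A j * (denom * gen j)) \<in> system_ideal n f"
    by (intro ideal_sum_closed[OF system_ideal(1)] A) simp
  then show ?thesis by (simp add: A(2) sum_distrib_left mult.left_commute)
qed

lemma is_root_x: "is_root n f x"
  unfolding is_root_def
proof (intro allI impI)
  fix i assume i: "i < n"
  have "coeff (\<rho> (f i)) 0 = 0" using contact[OF i] \<mu> by (simp add: monom_1_dvd_iff')
  then show "mp_eval (f i) x = 0" using coeff_\<rho>_0[of "f i"] f[OF i] by simp
qed

lemma root_near_x:
  assumes "is_root n f z" "mp_eval denom z \<noteq> 0" "i < n"
  shows "z i = x i"
proof -
  have gen0: "mp_eval (gen j) z = 0" if j: "j < n" for j
  proof -
    from denom_gen[OF j] obtain C where "denom * gen j = (\<Sum>i<n. C i * f i)" by (elim exE conjE)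
    then have "mp_eval denom z * mp_eval (gen j) z = (\<Sum>i<n. mp_eval (C i) z * mp_eval (f i) z)"
      by (simp flip: mp_eval.hom_mult mp_eval.hom_sum)
    then show ?thesis using assms(1,2) by (simp add: is_root_def)
  qed
  have z0: "z 0 = x 0"
    using gen0[of 0] n by (simp add: gen_def mp_eval.hom_power mp_eval_t)
  show ?thesis
  proof (cases "i = 0")
    case False
    then have "z i = poly (\<gamma> i) 0"
      using gen0[OF assms(3)] z0 by (simp add: gen_def mp_eval.hom_minus mp_eval_\<iota>)
    then show ?thesis using \<gamma>_x[OF assms(3)] by (simp add: poly_0_coeff_0)
  qed (simp add: z0)
qed

text \<open>Near \<open>x\<close> the polynomial \<open>denom\<close> has no zeros, so a root of the system is a zero of all generators
  of \<open>Q\<close>.\<close>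

theorem isolated_root_x: "isolated_root n f x"
  unfolding isolated_root_def
proof (intro conjI is_root_x, rule ccontr)
  assume "\<not> (\<exists>\<epsilon>>0. \<forall>z. (\<forall>i<n. \<bar>z i - x i\<bar> < \<epsilon>) \<and> is_root n f z \<longrightarrow> (\<forall>i<n. z i = x i))"
  then have "\<forall>k. \<exists>z. (\<forall>i<n. \<bar>z i - x i\<bar> < 1 / real (Suc k)) \<and> is_root n f z \<and> \<not> (\<forall>i<n. z i = x i)"
    by (metis zero_less_divide_1_iff of_nat_0_less_iff zero_less_Suc)
  then obtain z where z: "\<And>k i. i < n \<Longrightarrow> \<bar>z k i - x i\<bar> < 1 / real (Suc k)"
      "\<And>k. is_root n f (z k)" "\<And>k. \<not> (\<forall>i<n. z k i = x i)"
    by metis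
  have "(\<lambda>k. z k i) \<longlonglongrightarrow> x i" if "i < n" for i
  proof (rule LIMSEQ_I)
    fix r :: real assume "0 < r"
    then obtain K where K: "1 / real (Suc K) < r" using nat_approx_posE by blast
    have "norm (z k i - x i) < r" if "K \<le> k" for k
    proof -
      have "\<bar>z k i - x i\<bar> < 1 / real (Suc k)" using z(1) \<open>i < n\<close> .
      also have "\<dots> \<le> 1 / real (Suc K)" using that by (simp add: field_simps)
      finally show ?thesis using K by simp
    qed
    then show "\<exists>K. \<forall>k\<ge>K. norm (z k i - x i) < r" by blast
  qed
  then have "(\<lambda>k. mp_eval denom (z k)) \<longlonglongrightarrow> mp_eval denom x"
    using denom_in_R by (intro tendsto_mp_eval) auto
  then have "eventually (\<lambda>k. mp_eval denom (z k) \<noteq> 0) sequentially"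
    using mp_eval_denom by (rule tendsto_imp_eventually_ne)
  then obtain k where "mp_eval denom (z k) \<noteq> 0"
    using eventually_happens by force
  then show False using root_near_x[OF z(2)] z(3) by blast
qed

text \<open>The tangent vector of the arc lies in the kernel of the Jacobian matrix. Conversely, this matrix
  differs from the nonsingular contact matrix by a matrix of rank at most 1, as only the first column changes.\<close>

theorem breadth_one_x: "breadth_one n f x"
proof -
  let ?J = "jacobian n f x" and ?A = "map_mat (\<lambda>p. mp_eval p x) contact_matrix"
  interpret vec_space "TYPE(real)" n .
  have J: "?J \<in> carrier_mat n n" by (simp add: jacobian_def)
  have A: "?A \<in> carrier_mat n n" by (simp add: contact_matrix_def)
  have "det ?J = 0"
  proof -
    let ?v = "vec n (\<lambda>l. coeff (\<gamma> l) 1)"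
    have "?J *\<^sub>v ?v = 0\<^sub>v n"
    proof (rule eq_vecI)
      fix i assume "i < dim_vec (0\<^sub>v n :: real vec)"
      then have i: "i < n" by simp
      have "(?J *\<^sub>v ?v) $ i = (\<Sum>l<n. mp_eval (mp_pderiv l (f i)) x * coeff (\<gamma> l) 1)"
        using i by (simp add: jacobian_def scalar_prod_def atLeast0LessThan)
      also have "\<dots> = (\<Sum>l<n. coeff (\<rho> (mp_pderiv l (f i))) 0 * coeff (pderiv (\<gamma> l)) 0)"
        using mp_vars_pderiv[OF f[OF i]] by (intro sum.cong) (simp_all add: coeff_\<rho>_0 coeff_pderiv)
      also have "\<dots> = coeff (pderiv (\<rho> (f i))) 0"
        unfolding pderiv_restrict_to_arc[OF f[OF i] finite_lessThan] by (simp add: coeff_sum coeff_mult_0)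
      also have "\<dots> = 0"
        using contact[OF i] \<mu> by (simp add: coeff_pderiv monom_1_dvd_iff')
      finally show "(?J *\<^sub>v ?v) $ i = 0\<^sub>v n $ i" using i by simp
    qed (simp add: jacobian_def)
    moreover have "?v \<noteq> 0\<^sub>v n"
    proof
      assume "?v = 0\<^sub>v n"
      then have "?v $ 0 = 0\<^sub>v n $ 0" by simp
      then show False using n by (simp add: \<gamma>_0)
    qed
    ultimately have "?v \<in> carrier_vec n \<and> ?v \<noteq> 0\<^sub>v n \<and> ?J *\<^sub>v ?v = 0\<^sub>v n" by simp
    then show ?thesis unfolding det_0_iff_vec_prod_zero_field[OF J] by (rule exI)
  qed
  then have "rank ?J < n" using J det_zero_low_rank by blast
  moreover have "n \<le> rank ?J + 1"
  proof -
    define E where "E = mat n n (\<lambda>(i, l). (coeff (\<rho> (f i)) \<mu> - mp_eval (mp_pderiv 0 (f i)) x) *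
        (if l = 0 then 1 else 0))"
    have E: "E \<in> carrier_mat n n" by (simp add: E_def)
    have "?A = ?J + E"
      unfolding contact_matrix_at_root
      by (rule eq_matI) (auto simp: E_def jacobian_def)
    moreover have "rank ?A = n"
      using low_rank_det_zero[OF A det_contact_matrix_at_root] .
    moreover have "rank E \<le> 1"
      by (rule rank_le_1_product_entries[OF E, where
            f = "\<lambda>i. coeff (\<rho> (f i)) \<mu> - mp_eval (mp_pderiv 0 (f i)) x" and g = "\<lambda>l. if l = 0 then 1 else 0"])
        (simp add: E_def)
    ultimately show ?thesis using rank_subadditive[OF J E] by simp
  qed
  ultimately show ?thesis unfolding breadth_one_def by linarith
qed

lemma Q_iff: "p \<in> Q \<longleftrightarrow> p \<in> R \<and> monom 1 \<mu> dvd \<rho> p"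
  by (simp add: Q_def)

lemma ideal_Q: "ideal Q (mp_ring n)"
  unfolding ideal_iff Q_iff
  using closed_subringD[OF closed_R]
  by (auto simp: Q_iff \<rho>.hom_zero \<rho>.hom_add \<rho>.hom_mult simp del: mem_Collect_eq)

lemma one_notin_Q: "1 \<notin> Q"
  using \<mu> by (auto simp: Q_iff \<rho>.hom_one monom_1_dvd_iff')

lemma power_in_Q:
  assumes "p \<in> R" "mp_eval p x = 0" shows "p ^ \<mu> \<in> Q"
proof -
  have "monom 1 1 dvd \<rho> p"
    using coeff_\<rho>_0[OF assms(1)] assms(2) by (simp add: monom_1_dvd_iff')
  then have "(monom 1 1) ^ \<mu> dvd \<rho> (p ^ \<mu>)"
    unfolding \<rho>.hom_power by (rule dvd_power_same)
  then show ?thesis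
    using closed_subring_power[OF closed_R assms(1)] by (simp add: Q_iff monom_power)
qed

text \<open>If \<open>b(x) \<noteq> 0\<close>, then \<open>b\<close> restricted to the arc is a unit modulo \<open>t\<^sup>\<mu>\<close>; otherwise \<open>b\<^sup>\<mu> \<in> Q\<close>.\<close>

lemma primary_Q: "primary_ideal Q (mp_ring n)"
  unfolding primary_ideal_def
proof (intro conjI ballI impI ideal_Q)
  show "Q \<noteq> carrier (mp_ring n)"
    using one_notin_Q closed_subringD(1)[OF closed_R] by (metis mp_ring_simps(1))
  fix a b assume ab: "a \<in> carrier (mp_ring n)" "b \<in> carrier (mp_ring n)"
    and Q: "a \<otimes>\<^bsub>mp_ring n\<^esub> b \<in> Q"
  have aR: "a \<in> R" and bR: "b \<in> R" using ab by simp_all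
  show "a \<in> Q \<or> (\<exists>k::nat. b [^]\<^bsub>mp_ring n\<^esub> k \<in> Q)"
  proof (cases "mp_eval b x = 0")
    case True
    then have "b [^]\<^bsub>mp_ring n\<^esub> \<mu> \<in> Q"
      using power_in_Q[OF bR] by (simp add: mp_ring_eq_subset_ring nat_pow_subset_ring)
    then show ?thesis by blast
  next
    case False
    have "monom 1 \<mu> dvd \<rho> a * \<rho> b" using Q by (simp add: Q_iff \<rho>.hom_mult)
    then have "monom 1 \<mu> dvd \<rho> a"
      by (rule low_order_factor) (use False coeff_\<rho>_0[OF bR] in simp)
    then show ?thesis using aR by (simp add: Q_iff)
  qed
qed

lemma radical_Q: "ideal_radical (mp_ring n) Q = {p \<in> R. mp_eval p x = 0}"
proof (intro equalityI subsetI)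
  fix p assume "p \<in> {p \<in> R. mp_eval p x = 0}"
  then have "p \<in> R" "p ^ \<mu> \<in> Q" using power_in_Q by auto
  then show "p \<in> ideal_radical (mp_ring n) Q"
    unfolding ideal_radical_def by (auto simp: mp_ring_eq_subset_ring nat_pow_subset_ring)
next
  fix p assume "p \<in> ideal_radical (mp_ring n) Q"
  then obtain k where p: "p \<in> R" "p ^ k \<in> Q"
    unfolding ideal_radical_def by (auto simp: mp_ring_eq_subset_ring nat_pow_subset_ring)
  then have "coeff (\<rho> (p ^ k)) 0 = 0" using \<mu> by (simp add: Q_iff monom_1_dvd_iff')
  then have "mp_eval (p ^ k) x = 0"
    using coeff_\<rho>_0[OF closed_subring_power[OF closed_R p(1)]] by simp
  then show "p \<in> {p \<in> R. mp_eval p x = 0}" using p(1) by (simp add: mp_eval.hom_power)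
qed

lemma point_ideal_eq: "point_ideal n x = {p \<in> R. mp_eval p x = 0}"
proof
  let ?G = "(\<lambda>i. mp_var i - mp_const (x i)) ` {..<n}"
  have G: "?G \<subseteq> R"
  proof
    fix p assume "p \<in> ?G"
    then obtain i where "i < n" "p = mp_var i - mp_const (x i)" by blast
    then show "p \<in> R" using closed_subringD(5)[OF closed_R, of "mp_var i" "mp_const (x i)"] by simp
  qed
  have m: "ideal {p \<in> R. mp_eval p x = 0} (mp_ring n)"
    unfolding ideal_iff
  proof (intro conjI ballI)
    show "0 \<in> {p \<in> R. mp_eval p x = 0}" by (simp add: mp_eval.hom_zero)
    fix p q assume "p \<in> {p \<in> R. mp_eval p x = 0}" "q \<in> {p \<in> R. mp_eval p x = 0}"
    then show "p + q \<in> {p \<in> R. mp_eval p x = 0}"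
      using closed_subringD(4)[OF closed_R, of p q] by (simp add: mp_eval.hom_add)
  next
    fix a p assume "a \<in> R" "p \<in> {p \<in> R. mp_eval p x = 0}"
    then show "a * p \<in> {p \<in> R. mp_eval p x = 0}"
      using closed_subringD(6)[OF closed_R, of a p] by (simp add: mp_eval.hom_mult)
  qed blast
  show "point_ideal n x \<subseteq> {p \<in> R. mp_eval p x = 0}"
    unfolding point_ideal_def
    by (rule P.genideal_minimal[OF m]) (use G in \<open>auto simp: mp_eval.hom_minus\<close>)
  have I: "ideal (point_ideal n x) (mp_ring n)" and GI: "?G \<subseteq> point_ideal n x"
    unfolding point_ideal_def using P.genideal_ideal[of ?G] P.genideal_self[of ?G] G by simp_all
  note I' = I[unfolded ideal_iff]
  show "{p \<in> R. mp_eval p x = 0} \<subseteq> point_ideal n x"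
  proof
    fix p assume p: "p \<in> {p \<in> R. mp_eval p x = 0}"
    then have "mp_vars p \<subseteq> {..<n}" by simp
    then have "p - mp_const (mp_eval p x) \<in> point_ideal n x"
    proof (induction rule: mp_induct)
      case (const c)
      show ?case using I' by simp
    next
      case (var i)
      then show ?case using GI by auto
    next
      case (add p q)
      have "p + q - mp_const (mp_eval (p + q) x) =
          (p - mp_const (mp_eval p x)) + (q - mp_const (mp_eval q x))"
        by (simp add: mp_eval.hom_add mp_const.hom_add)
      then show ?case using I' add(3,4) by (simp only:)
    next
      case (mult p q)
      have "p * q - mp_const (mp_eval (p * q) x) =
          p * (q - mp_const (mp_eval q x)) + mp_const (mp_eval q x) * (p - mp_const (mp_eval p x))"
        by (simp add: mp_eval.hom_mult mp_const.hom_mult algebra_simps)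
      moreover have "p \<in> R" "mp_const (mp_eval q x) \<in> R" using mult(1) by simp_all
      ultimately show ?case using I' mult(3,4) by (simp only:)
    qed
    then show "p \<in> point_ideal n x" using p by (simp add: mp_const.hom_zero)
  qed
qed

lemma isolated_component_Q:
  "isolated_primary_component (mp_ring n) (system_ideal n f) (point_ideal n x) Q"
proof -
  have "noetherian_cring (mp_ring n)"
    by (intro noetherian_cring.intro noetherian_mp_ring P.cring_axioms)
  then interpret N: noetherian_cring "mp_ring n" .
  have fQ: "f ` {..<n} \<subseteq> Q" using f contact by (auto simp: Q_def)
  have "isolated_primary_component (mp_ring n) (system_ideal n f) (ideal_radical (mp_ring n) Q) Q"
  proof (rule N.isolated_primary_componentI[OF system_ideal(1) primary_Q, where s = denom])
    show "system_ideal n f \<subseteq> Q" by (rule system_ideal_minimal[OF ideal_Q fQ])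
    show "denom \<in> carrier (mp_ring n)" using denom_in_R by simp
    show "denom \<notin> ideal_radical (mp_ring n) Q" using mp_eval_denom by (simp add: radical_Q)
    show "denom \<otimes>\<^bsub>mp_ring n\<^esub> q \<in> system_ideal n f" if "q \<in> Q" for q
      using denom_Q[OF that] by simp
  qed
  then show ?thesis by (simp add: point_ideal_eq radical_Q)
qed

text \<open>The quotient is \<open>\<real>[t]/(t\<^sup>\<mu>)\<close>, filtered by the order of vanishing along the arc. Each step of the
  filtration adds one line, spanned by the class of a power of \<open>t\<close>.\<close>

lemma dimension_quotient:
  "ring.dimension (mp_ring n Quot Q) \<mu> (range (\<lambda>c. Q +>\<^bsub>mp_ring n\<^esub> mp_const c))
     (carrier (mp_ring n Quot Q))"
proof -
  interpret Q: ideal Q "mp_ring n" by (rule ideal_Q)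
  interpret quot: ring "mp_ring n Quot Q" by (rule Q.quotient_is_ring)
  let ?c = "\<lambda>p. Q +>\<^bsub>mp_ring n\<^esub> p" and ?K = "range (\<lambda>c. Q +>\<^bsub>mp_ring n\<^esub> mp_const c)"
  have car: "carrier (mp_ring n Quot Q) = ?c ` R"
    by (auto simp: FactRing_def A_RCOSETS_def')
  have add: "?c p \<oplus>\<^bsub>mp_ring n Quot Q\<^esub> ?c q = ?c (p + q)" if "p \<in> R" "q \<in> R" for p q
    using Q.a_rcos_sum[of p q] that by (simp add: FactRing_def)
  have mult: "?c p \<otimes>\<^bsub>mp_ring n Quot Q\<^esub> ?c q = ?c (p * q)" if "p \<in> R" "q \<in> R" for p q
    using Q.rcoset_mult_add[of p q] that by (simp add: FactRing_def)
  have eqD: "p - q \<in> Q" if "?c p = ?c q" for p q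
  proof -
    have coset: "z \<in> ?c r \<longleftrightarrow> (\<exists>h\<in>Q. z = h + r)" for z r
      unfolding a_r_coset_def' by simp
    have "0 \<in> Q" using ideal_Q unfolding ideal_iff by (elim conjE)
    then have "p \<in> ?c p" unfolding coset by (intro bexI[of _ 0]) simp_all
    then have "p \<in> ?c q" using that by simp
    then obtain h where "h \<in> Q" "p = h + q" unfolding coset by (elim bexE)
    then show ?thesis by simp
  qed
  \<comment> \<open>the classes of the polynomials of order at least \<open>\<mu> - d\<close> along the arc\<close>
  define E where "E d = ?c ` {p \<in> R. monom 1 (\<mu> - d) dvd \<rho> p}" for d
  have E_iff: "u \<in> E d \<longleftrightarrow> (\<exists>p\<in>R. u = ?c p \<and> monom 1 (\<mu> - d) dvd \<rho> p)" for u d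
    unfolding E_def by auto
  have const_R: "mp_const c \<in> R" for c by simp
  have "quot.dimension d ?K (E d)" if "d \<le> \<mu>" for d
    using that
  proof (induction d)
    case 0
    have "E 0 = {\<zero>\<^bsub>mp_ring n Quot Q\<^esub>}"
    proof -
      have "E 0 = ?c ` Q" by (simp add: E_def Q_def)
      also have "\<dots> = (\<lambda>_. Q) ` Q"
        by (intro image_cong refl) (rule P.a_rcos_zero[OF ideal_Q])
      also have "\<dots> = {Q}" using ideal_Q unfolding ideal_iff by (auto simp del: mem_Collect_eq)
      finally show ?thesis by (simp add: FactRing_def)
    qed
    then show ?case by simp
  next
    case (Suc d)
    define m where "m = \<mu> - Suc d"
    have m: "\<mu> - d = Suc m" "m < \<mu>" using Suc(2) by (auto simp: m_def)
    have tm: "t ^ m \<in> R" by (rule closed_subring_power[OF closed_R t_in_R])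
    have \<rho>tm: "\<rho> (t ^ m) = monom 1 m" by (simp add: \<rho>.hom_power \<rho>_t monom_altdef)
    have "?c (t ^ m) \<notin> E d"
    proof
      assume "?c (t ^ m) \<in> E d"
      then obtain p where p: "?c (t ^ m) = ?c p" "monom 1 (Suc m) dvd \<rho> p"
        unfolding E_iff m(1) by (elim bexE conjE)
      have "monom 1 \<mu> dvd \<rho> (t ^ m - p)" using eqD[OF p(1)] by (simp add: Q_iff)
      then have "coeff (\<rho> (t ^ m) - \<rho> p) m = 0" using m(2) by (simp add: \<rho>.hom_minus monom_1_dvd_iff')
      moreover have "coeff (\<rho> p) m = 0" using p(2) by (simp add: monom_1_dvd_iff')
      ultimately show False by (simp add: \<rho>tm)
    qed
    moreover have "?c (t ^ m) \<in> carrier (mp_ring n Quot Q)" unfolding car using tm by (rule imageI)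
    ultimately have "quot.dimension (Suc d) ?K (quot.line_extension ?K (?c (t ^ m)) (E d))"
      using Suc by (intro quot.Suc_dim) auto
    moreover have "quot.line_extension ?K (?c (t ^ m)) (E d) = E (Suc d)"
    proof (intro equalityI subsetI)
      fix u assume "u \<in> quot.line_extension ?K (?c (t ^ m)) (E d)"
      then obtain k v where kv: "k \<in> ?K" "v \<in> E d"
        "u = k \<otimes>\<^bsub>mp_ring n Quot Q\<^esub> ?c (t ^ m) \<oplus>\<^bsub>mp_ring n Quot Q\<^esub> v"
        unfolding quot.line_extension_mem_iff by (elim bexE)
      from kv(1) obtain c where c: "k = ?c (mp_const c)" by (elim rangeE)
      from kv(2) obtain p where p: "p \<in> R" "v = ?c p" "monom 1 (Suc m) dvd \<rho> p"
        unfolding E_iff m(1) by (elim bexE conjE)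
      have u: "u = ?c (mp_const c) \<otimes>\<^bsub>mp_ring n Quot Q\<^esub> ?c (t ^ m) \<oplus>\<^bsub>mp_ring n Quot Q\<^esub> ?c p"
        by (simp only: kv(3) c p(2))
      have ct: "mp_const c * t ^ m \<in> R" by (rule closed_subringD(6)[OF closed_R const_R tm])
      have "u = ?c (mp_const c * t ^ m + p)"
        unfolding u mult[OF const_R tm] by (rule add[OF ct p(1)])
      moreover have "monom 1 m dvd \<rho> (mp_const c * t ^ m + p)"
        using p(3) by (simp add: \<rho>.hom_add \<rho>.hom_mult \<rho>tm \<rho>.subst_const monom_1_dvd_iff')
      moreover have "mp_const c * t ^ m + p \<in> R" by (rule closed_subringD(4)[OF closed_R ct p(1)])
      ultimately show "u \<in> E (Suc d)" unfolding E_iff m_def[symmetric] by (intro bexI conjI)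
    next
      fix u assume "u \<in> E (Suc d)"
      then obtain p where p: "p \<in> R" "u = ?c p" "monom 1 m dvd \<rho> p"
        unfolding E_iff m_def[symmetric] by (elim bexE conjE)
      let ?a = "mp_const (coeff (\<rho> p) m)"
      have at: "?a * t ^ m \<in> R" by (rule closed_subringD(6)[OF closed_R const_R tm])
      have r: "p - ?a * t ^ m \<in> R" by (rule closed_subringD(5)[OF closed_R p(1) at])
      have "monom 1 (Suc m) dvd \<rho> (p - ?a * t ^ m)"
        using p(3)
        by (auto simp: \<rho>.hom_minus \<rho>.hom_mult \<rho>tm \<rho>.subst_const monom_1_dvd_iff' less_Suc_eq)
      then have "?c (p - ?a * t ^ m) \<in> E d" unfolding E_iff m(1) by (intro bexI[OF _ r] conjI[OF refl])
      moreover have "u = ?c ?a \<otimes>\<^bsub>mp_ring n Quot Q\<^esub> ?c (t ^ m) \<oplus>\<^bsub>mp_ring n Quot Q\<^esub> ?c (p - ?a * t ^ m)"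
        unfolding mult[OF const_R tm] add[OF at r] p(2) by simp
      ultimately show "u \<in> quot.line_extension ?K (?c (t ^ m)) (E d)"
        unfolding quot.line_extension_mem_iff by (intro bexI[of _ "?c ?a"] bexI rangeI)
    qed
    ultimately show ?case by simp
  qed
  from this[OF order_refl] have "quot.dimension \<mu> ?K (E \<mu>)" .
  moreover have "E \<mu> = carrier (mp_ring n Quot Q)"
    unfolding E_def car by (simp add: monom_1_dvd_iff')
  ultimately show ?thesis by simp
qed

theorem root_multiplicity_x: "root_multiplicity n f x \<mu>"
  unfolding root_multiplicity_def using isolated_component_Q dimension_quotient by blast

end

section \<open>Verified roots of the deflated system\<close>

theorem theorem4p5:
  fixes n \<mu> :: nat
    and F :: "nat \<Rightarrow> mpoly"
    and yt yh xh bh :: "nat \<Rightarrow> real"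
    and ah :: "nat \<Rightarrow> nat \<Rightarrow> real"
    and Y :: "nat \<Rightarrow> real interval"
    and M :: "nat \<Rightarrow> nat \<Rightarrow> real interval"
  assumes "n \<ge> 1" and "\<mu> \<ge> 2"
    and "\<And>i. i < n \<Longrightarrow> F i \<in> carrier (mp_ring n)"
    and "verification_applicable (\<mu> * n) (deflated_system n \<mu> F) yt Y M"
    and "in_box (\<mu> * n) yh Y"
    and "is_root (\<mu> * n) (deflated_system n \<mu> F) yh"
    and "\<And>i. i < n \<Longrightarrow> yh i = xh i"
    and "\<And>\<nu>. \<nu> \<le> \<mu> - 2 \<Longrightarrow> yh (b_index n \<nu>) = bh \<nu>"
    and "\<And>k j. 2 \<le> k \<Longrightarrow> k \<le> \<mu> \<Longrightarrow> 1 \<le> j \<Longrightarrow> j < n \<Longrightarrow> yh (a_index n \<mu> k j) = ah k j"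
  shows "isolated_root n (F1 \<mu> F (\<lambda>\<nu>. mp_const (bh \<nu>))) xh \<and>
         breadth_one n (F1 \<mu> F (\<lambda>\<nu>. mp_const (bh \<nu>))) xh \<and>
         root_multiplicity n (F1 \<mu> F (\<lambda>\<nu>. mp_const (bh \<nu>))) xh \<mu>"
proof -
  have inj: "injective_jacobian (\<mu> * n) (deflated_system n \<mu> F) yh"
    using assms(4,5) by (rule verification_imp_injective_jacobian)
  have F: "mp_vars (F i) \<subseteq> {..<n}" if "i < n" for i
    using assms(3)[OF that] by (simp add: mp_ring_def)
  interpret D: deflation_point n \<mu> F yh bh
    by (rule deflation_point.intro) (fact assms(1,2) F assms(8))+
  have eval_x: "mp_eval (mp_pderiv l (D.F0 i)) xh = mp_eval (mp_pderiv l (D.F0 i)) yh"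
    if "i < n" for i l
  proof (rule mp_eval_cong)
    fix k assume "k \<in> mp_vars (mp_pderiv l (D.F0 i))"
    then have "k < n" using mp_vars_pderiv[OF D.mp_vars_F0[OF that]] by blast
    then show "xh k = yh k" by (simp add: assms(7))
  qed
  interpret C: arc_contact n \<mu> D.F0 D.arc xh
  proof
    show "D.arc 0 = [:xh 0, 1:]"
      using deflation_arc_first[OF assms(1,2)] assms(1,7) by simp
    show "coeff (D.arc l) 0 = xh l" if "l < n" for l
      using that assms(7) by (simp add: coeff_deflation_arc_0)
    show "monom 1 \<mu> dvd restrict_to_arc D.arc (D.F0 i)" if "i < n" for i
      using D.root_imp_order[OF assms(6) that] by (simp add: monom_1_dvd_iff')
    show "w l = 0" if "\<And>i. i < n \<Longrightarrow> w 0 * coeff (restrict_to_arc D.arc (D.F0 i)) \<mu> +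
        (\<Sum>l=1..<n. mp_eval (mp_pderiv l (D.F0 i)) xh * w l) = 0" "l < n" for w l
      using D.contact_matrix_injective[OF assms(6) inj _ that(2), of w] that(1)
      by (simp add: eval_x)
  qed (use assms(1,2) D.mp_vars_F0 in auto)
  show ?thesis
    using C.isolated_root_x C.breadth_one_x C.root_multiplicity_x by blast
qed

end
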